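(* Let $p=6$. Then, for every compact connected metric graph $\mathcal G$, $\mu_1(\mathcal G,6)\ge\frac{\pi}{2}$. Moreover, if $\mathcal G$ admits a cycle covering, then $\mu_1(\mathcal G,6)\ge\pi$.
   Context: A compact metric graph $\mathcal G$ is formed by finitely many edges (bounded intervals $I_e=[0,\ell_e]$, $0<\ell_e<\infty$) with some endpoints glued together at vertices; self-loops and multiple edges are allowed. All graphs are connected. $|\mathcal G|=\sum_e\ell_e$ is the total length. Integrals and $L^p(\mathcal G)$ norms $\|\cdot\|_p$ of functions on $\mathcal G$ are defined edge by edge with Lebesgue measure. $H^1(\mathcal G)$ is the space of continuous $u:\mathcal G\to\mathbb C$ whose restriction $u_e$ to each edge is in $H^1(I_e)$, with norm $\|u'\|_2+\|u\|_2$. For $\mu>0$, $H^1_\mu(\mathcal G)=\{u\in H^1(\mathcal G):\|u\|_2^2=\mu\}$. $\mathcal G$ admits a cycle covering if it can be covered by cycles, a cycle being a closed path (loop) in $\mathcal G$ without edge repetitions; i.e. every edge belongs to some cycle. Let $E(u)=\frac12\|u'\|_2^2-\frac16\|u\|_6^6$ and $\kappa_\mu=\sqrt{\mu/|\mathcal G|}$ (constant function). $\mu_1(\mathcal G,6)>0$ denotes the threshold mass for local minimality of the constants: $\kappa_\mu$ is a local minimizer (in the $H^1$ topology) of $E$ in $H^1_\mu(\mathcal G)$ for $\mu<\mu_1(\mathcal G,6)$, and is not for $\mu>\mu_1(\mathcal G,6)$. In the paper it is defined explicitly by $$\mu_1(\mathcal G,6)=|\mathcal G|\left(\frac{\lambda_2(\mathcal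 G)}{4}\right)^{1/2},\qquad \lambda_2(\mathcal G)=\inf\left\{\frac{\int_{\mathcal G}|\varphi'|^2\,dx}{\int_{\mathcal G}|\varphi|^2\,dx}:\ \varphi\in H^1(\mathcal G)\setminus\{0\},\ \int_{\mathcal G}\varphi\,dx=0\right\}.$$ *)

theory Defs
  imports "Graph_Theory.Digraph_Component" "HOL-Analysis.Analysis"
begin

section \<open>Compact metric graphs\<close>

text \<open>
  The edges are the arcs of a finite directed multigraph: the edge \<open>e\<close> is the interval
  \<open>[0, len e]\<close>, with the endpoint \<open>0\<close> glued to the vertex \<open>tail G e\<close> and the endpoint \<open>len e\<close>
  glued to \<open>head G e\<close>. The direction of an arc only fixes this parametrization; connectedness
  (of the underlying undirected graph) and the cycles below ignore it. Self-loops and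
  parallel edges are allowed. The constant \<^const>\<open>Digraph_Component.connected\<close> is written
  qualified because the topological notion has the same base name.
\<close>

locale compact_metric_graph = fin_digraph G
  for G :: "('v, 'e) pre_digraph" (structure) +
  fixes len :: "'e \<Rightarrow> real"
  assumes arcs_nonempty: "arcs G \<noteq> {}"
    and len_pos: "\<And>e. e \<in> arcs G \<Longrightarrow> 0 < len e"
    and graph_connected: "Digraph_Component.connected G"

definition total_length :: "('v, 'e) pre_digraph \<Rightarrow> ('e \<Rightarrow> real) \<Rightarrow> real" where
  "total_length G len = (\<Sum>e\<in>arcs G. len e)"

section \<open>Cycle coverings\<close>

text \<open>
  Every edge may be traversed in both directions, so each arc \<open>e\<close> is replaced by the two
  arcs \<open>(e, True)\<close> and \<open>(e, False)\<close>.
\<close>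

definition both_directions :: "('v, 'e) pre_digraph \<Rightarrow> ('v, 'e \<times> bool) pre_digraph" where
  "both_directions G = \<lparr> verts = verts G, arcs = arcs G \<times> UNIV,
     tail = (\<lambda>(e, b). if b then tail G e else head G e),
     head = (\<lambda>(e, b). if b then head G e else tail G e) \<rparr>"

text \<open>
  No edge may occur twice, not even once in each direction; vertices may be repeated.
\<close>

definition graph_cycle :: "('v, 'e) pre_digraph \<Rightarrow> ('e \<times> bool) list \<Rightarrow> bool" where
  "graph_cycle G p \<longleftrightarrow> p \<noteq> [] \<and> distinct (map fst p) \<and>
     (\<exists>v. pre_digraph.awalk (both_directions G) v p v)"

definition admits_cycle_covering :: "('v, 'e) pre_digraph \<Rightarrow> bool" where
  "admits_cycle_covering G \<longleftrightarrow> (\<forall>e\<in>arcs G. \<exists>p. graph_cycle G p \<and> e \<in> fst ` set p)"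

section \<open>The Sobolev space on a bounded interval\<close>

definition L2_interval :: "real \<Rightarrow> (real \<Rightarrow> complex) \<Rightarrow> bool" where
  "L2_interval l f \<longleftrightarrow> f \<in> borel_measurable (lebesgue_on {0..l}) \<and>
     integrable (lebesgue_on {0..l}) (\<lambda>x. (cmod (f x))\<^sup>2)"

text \<open>
  Weak derivatives are tested, as in Brezis, Functional Analysis, Sobolev Spaces and Partial
  Differential Equations, Section 8.2, against continuously differentiable functions with
  compact support in the open interval \<open>(0, l)\<close>.
\<close>

definition test_function :: "real \<Rightarrow> (real \<Rightarrow> real) \<Rightarrow> bool" where
  "test_function l \<phi> \<longleftrightarrow> (\<forall>x. \<phi> differentiable at x) \<and> continuous_on UNIV (deriv \<phi>) \<and>
     (\<exists>a b. 0 < a \<and> a \<le> b \<and> b < l \<and> (\<forall>x. x \<notin> {a..b} \<longrightarrow> \<phi> x = 0))"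

definition weak_deriv :: "real \<Rightarrow> (real \<Rightarrow> complex) \<Rightarrow> (real \<Rightarrow> complex) \<Rightarrow> bool" where
  "weak_deriv l u g \<longleftrightarrow> (\<forall>\<phi>. test_function l \<phi> \<longrightarrow>
     (\<integral>x. u x * of_real (deriv \<phi> x) \<partial>(lebesgue_on {0..l})) =
     - (\<integral>x. g x * of_real (\<phi> x) \<partial>(lebesgue_on {0..l})))"

definition H1_interval :: "real \<Rightarrow> (real \<Rightarrow> complex) set" where
  "H1_interval l = {u. L2_interval l u \<and> (\<exists>g. L2_interval l g \<and> weak_deriv l u g)}"

text \<open>
  The weak derivative is determined up to a null set, so the integrals formed with it below
  do not depend on the choice made here.
\<close>

definition H1_deriv :: "real \<Rightarrow> (real \<Rightarrow> complex) \<Rightarrow> real \<Rightarrow> complex" where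
  "H1_deriv l u = (SOME g. L2_interval l g \<and> weak_deriv l u g)"

section \<open>Functions on a metric graph\<close>

text \<open>
  A function on the graph is given by its restrictions \<open>u e\<close> to the edges, in the
  parametrization by \<open>[0, len e]\<close>; the values of \<open>u e\<close> outside this interval are irrelevant.
  It is continuous if it is continuous on each closed edge and the values at all edge ends
  glued to the same vertex \<open>v\<close> agree, \<open>U v\<close> being the common value.
\<close>

definition graph_continuous ::
    "('v, 'e) pre_digraph \<Rightarrow> ('e \<Rightarrow> real) \<Rightarrow> ('e \<Rightarrow> real \<Rightarrow> complex) \<Rightarrow> bool" where
  "graph_continuous G len u \<longleftrightarrow> (\<forall>e\<in>arcs G. continuous_on {0..len e} (u e)) \<and>
     (\<exists>U. \<forall>e\<in>arcs G. u e 0 = U (tail G e) \<and> u e (len e) = U (head G e))"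

definition graph_H1 ::
    "('v, 'e) pre_digraph \<Rightarrow> ('e \<Rightarrow> real) \<Rightarrow> ('e \<Rightarrow> real \<Rightarrow> complex) set" where
  "graph_H1 G len = {u. graph_continuous G len u \<and> (\<forall>e\<in>arcs G. u e \<in> H1_interval (len e))}"

definition graph_integral ::
    "('v, 'e) pre_digraph \<Rightarrow> ('e \<Rightarrow> real) \<Rightarrow>
      ('e \<Rightarrow> real \<Rightarrow> 'b::{banach, second_countable_topology}) \<Rightarrow> 'b" where
  "graph_integral G len f = (\<Sum>e\<in>arcs G. \<integral>x. f e x \<partial>(lebesgue_on {0..len e}))"

definition rayleigh_quotient ::
    "('v, 'e) pre_digraph \<Rightarrow> ('e \<Rightarrow> real) \<Rightarrow> ('e \<Rightarrow> real \<Rightarrow> complex) \<Rightarrow> real" where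
  "rayleigh_quotient G len u =
     graph_integral G len (\<lambda>e x. (cmod (H1_deriv (len e) (u e) x))\<^sup>2) /
     graph_integral G len (\<lambda>e x. (cmod (u e x))\<^sup>2)"

definition lambda2 :: "('v, 'e) pre_digraph \<Rightarrow> ('e \<Rightarrow> real) \<Rightarrow> real" where
  "lambda2 G len = Inf {rayleigh_quotient G len \<phi> | \<phi>. \<phi> \<in> graph_H1 G len \<and>
     (\<exists>e\<in>arcs G. \<exists>x\<in>{0..len e}. \<phi> e x \<noteq> 0) \<and> graph_integral G len \<phi> = 0}"

text \<open>The threshold mass \<open>\<mu>\<^sub>1(\<G>, p)\<close> for the exponent \<open>p = 6\<close>.\<close>

definition mu1_p6 :: "('v, 'e) pre_digraph \<Rightarrow> ('e \<Rightarrow> real) \<Rightarrow> real" where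
  "mu1_p6 G len = total_length G len * sqrt (lambda2 G len / 4)"

end

theory Submission
  imports Defs
begin

text \<open>
  Let \<open>L\<close> be the total length. The claim is \<open>lambda2 G len \<ge> (k * pi / L)\<^sup>2\<close>, with \<open>k = 1\<close> for every graph and
  \<open>k = 2\<close> if the graph has a cycle covering. The mechanism is that a function on the graph which takes
  values on both sides of a level \<open>t\<close> crosses that level at least \<open>k\<close> times: the vertices with value at
  most \<open>t\<close> and the remaining ones are separated by a cut, which is nonempty by connectedness; and it
  contains at least two edges if there is a cycle covering, because a cycle without repeated edges
  meets every cut in an even number of edges. If all vertices lie on the same side of \<open>t\<close>, then the
  interior of some edge is crossed twice.

  Counting the crossings of all levels in \<open>[A, B]\<close> gives a coarea-type bound
  (\<open>graph_layer_bound\<close>): if the real function \<open>w\<close> takes a value \<open>\<le> A\<close> and a value \<open>\<ge> B\<close>, then the integral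
  of \<open>\<bar>w'\<bar>\<close> over the layer \<open>{A < w < B}\<close> is at least \<open>k * (B - A)\<close>. By the Cauchy-Schwarz inequality
  the layer carries at least the energy \<open>(k * (B - A))\<^sup>2 / g\<close>, where \<open>g\<close> is its measure. This is \<open>k\<^sup>2\<close> times
  the energy of a linear function that rises from \<open>A\<close> to \<open>B\<close> on an interval of length \<open>g\<close>. Slicing
  \<open>{w > 0}\<close> into thin layers therefore compares \<open>w\<close> with a piecewise linear monotone function on an
  interval \<open>[0, m]\<close> that vanishes at one end, where \<open>m\<close> is the measure of \<open>{w > 0}\<close>; the lowest frequency
  of such functions is \<open>pi / (2 * m)\<close>, whence (\<open>superlevel_poincare\<close>)
  \<open>\<integral>\<^bsub>w>0\<^esub> \<bar>w'\<bar>\<^sup>2 \<ge> (k * pi / (2 * m))\<^sup>2 * \<integral>\<^bsub>w>0\<^esub> w\<^sup>2\<close>.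

  If \<open>w\<close> has mean zero and \<open>a\<close> is a median of \<open>w\<close>, then this inequality applies to \<open>w - a\<close> and to
  \<open>a - w\<close> with \<open>m = L / 2\<close>. The sum of the two is \<open>\<integral>\<bar>w'\<bar>\<^sup>2 \<ge> (k * pi / L)\<^sup>2 * \<integral>\<bar>w - a\<bar>\<^sup>2\<close>, and the last integral is
  at least \<open>\<integral>w\<^sup>2\<close> (\<open>mean_zero_poincare\<close>). A complex function is treated through its real and
  imaginary parts.
\<close>

section \<open>A Poincare inequality from a lower bound on the variation across layers\<close>

text \<open>
  The sharp inequality \<open>\<integral>w'\<^sup>2 \<ge> \<beta>\<^sup>2 * \<integral>w\<^sup>2\<close> with boundary terms for the linear function \<open>w\<close> on \<open>[s, s + g]\<close> that
  falls from \<open>t'\<close> to \<open>t\<close>. The boundary terms come from \<open>F = - \<beta> * tan (\<beta> * \<sigma>) * w\<^sup>2\<close>, which satisfies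
  \<open>F' \<le> w'\<^sup>2 - \<beta>\<^sup>2 * w\<^sup>2\<close> by completing a square; they telescope when adjacent intervals are joined. The integral of \<open>w\<^sup>2\<close> is replaced by its lower
  bound \<open>g * t\<^sup>2\<close>.
\<close>

lemma tangent_layer_bound:
  fixes \<beta> s g t t' :: real
  assumes \<beta>: "0 < \<beta>" and s: "0 \<le> s" and g: "0 < g" and small: "\<beta> * (s + g) < pi / 2"
    and t: "0 \<le> t" "t \<le> t'"
  shows "\<beta>\<^sup>2 * g * t\<^sup>2 - \<beta> * tan (\<beta> * (s + g)) * t\<^sup>2 + \<beta> * tan (\<beta> * s) * t'\<^sup>2 \<le> (t' - t)\<^sup>2 / g"
proof -
  define d where "d = (t' - t) / g"
  define w where "w = (\<lambda>\<sigma>. t + (s + g - \<sigma>) * d)"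
  define F where "F = (\<lambda>\<sigma>. - \<beta> * tan (\<beta> * \<sigma>) * (w \<sigma>)\<^sup>2)"
  define F' where "F' = (\<lambda>\<sigma>. - \<beta>\<^sup>2 * (1 + (tan (\<beta> * \<sigma>))\<^sup>2) * (w \<sigma>)\<^sup>2 + 2 * \<beta> * tan (\<beta> * \<sigma>) * w \<sigma> * d)"
  have d0: "0 \<le> d" using t g by (simp add: d_def)
  have deriv: "(F has_real_derivative F' \<sigma>) (at \<sigma>)" if "s \<le> \<sigma>" "\<sigma> \<le> s + g" for \<sigma>
  proof -
    have "\<beta> * \<sigma> \<le> \<beta> * (s + g)" using that \<beta> by simp
    then have "\<beta> * \<sigma> < pi / 2" using small by linarith
    moreover have "0 \<le> \<beta> * \<sigma>" using that \<beta> s by simp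
    ultimately have c: "cos (\<beta> * \<sigma>) > 0" by (intro cos_gt_zero_pi) (use pi_gt_zero in linarith)+
    have inv: "inverse ((cos (\<beta> * \<sigma>))\<^sup>2) = 1 + (tan (\<beta> * \<sigma>))\<^sup>2"
      using tan_sec[of "\<beta> * \<sigma>"] c by (simp add: power_inverse)
    have "(F has_real_derivative
        (- \<beta> * (inverse ((cos (\<beta> * \<sigma>))\<^sup>2) * \<beta>)) * (w \<sigma>)\<^sup>2 + (2 * w \<sigma> * (- d)) * (- \<beta> * tan (\<beta> * \<sigma>))) (at \<sigma>)"
      unfolding F_def w_def using c
      by (auto intro!: derivative_eq_intros simp: algebra_simps)
    then show ?thesis unfolding inv F'_def by (simp add: algebra_simps power2_eq_square)
  qed
  obtain \<sigma> where \<sigma>: "s < \<sigma>" "\<sigma> < s + g" and mvt: "F (s + g) - F s = (s + g - s) * F' \<sigma>"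
    using MVT2[of s "s + g" F F'] deriv g by auto
  have "t \<le> w \<sigma>" using \<sigma> d0 by (simp add: w_def)
  then have "t\<^sup>2 \<le> (w \<sigma>)\<^sup>2" using t by (intro power_mono) auto
  then have w2: "\<beta>\<^sup>2 * t\<^sup>2 \<le> \<beta>\<^sup>2 * (w \<sigma>)\<^sup>2" by (intro mult_left_mono) auto
  have "d\<^sup>2 - \<beta>\<^sup>2 * (w \<sigma>)\<^sup>2 - F' \<sigma> = (d - \<beta> * tan (\<beta> * \<sigma>) * w \<sigma>)\<^sup>2"
    unfolding F'_def by (simp add: algebra_simps power2_eq_square)
  then have "F' \<sigma> \<le> d\<^sup>2 - \<beta>\<^sup>2 * (w \<sigma>)\<^sup>2" by (smt (verit) zero_le_power2)
  then have "F' \<sigma> \<le> d\<^sup>2 - \<beta>\<^sup>2 * t\<^sup>2" using w2 by linarith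
  then have "F (s + g) - F s \<le> g * (d\<^sup>2 - \<beta>\<^sup>2 * t\<^sup>2)" using mvt g by simp
  moreover have "F (s + g) = - \<beta> * tan (\<beta> * (s + g)) * t\<^sup>2" by (simp add: F_def w_def)
  moreover have "F s = - \<beta> * tan (\<beta> * s) * t'\<^sup>2" using g by (simp add: F_def w_def d_def)
  moreover have "g * d\<^sup>2 = (t' - t)\<^sup>2 / g" using g by (simp add: d_def power2_eq_square)
  ultimately show ?thesis by (simp add: algebra_simps)
qed

lemma (in finite_measure) integrable_of_square:
  fixes D :: "'a \<Rightarrow> real"
  assumes "D \<in> borel_measurable M" and "integrable M (\<lambda>x. (D x)\<^sup>2)"
  shows "integrable M D"
proof (rule Bochner_Integration.integrable_bound)
  show "integrable M (\<lambda>x. 1 + (D x)\<^sup>2)" using assms(2) by simp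
  show "AE x in M. norm (D x) \<le> norm (1 + (D x)\<^sup>2)"
  proof (rule AE_I2)
    fix x
    have "0 \<le> (\<bar>D x\<bar> - 1)\<^sup>2" by simp
    then have "2 * \<bar>D x\<bar> \<le> 1 + (D x)\<^sup>2" by (simp add: power2_eq_square algebra_simps)
    then show "norm (D x) \<le> norm (1 + (D x)\<^sup>2)" by simp
  qed
qed (use assms in auto)

text \<open>
  The Cauchy-Schwarz inequality on \<open>S\<close>, in a form that also yields that \<open>S\<close> is not a null set.
\<close>

lemma (in finite_measure) layer_energy:
  fixes D :: "'a \<Rightarrow> real"
  assumes S: "S \<in> sets M" and D: "D \<in> borel_measurable M" "integrable M (\<lambda>x. (D x)\<^sup>2)"
    and c: "0 < c" "c \<le> (LINT x:S|M. D x)"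
  shows "0 < measure M S" and "c\<^sup>2 / measure M S \<le> (LINT x:S|M. (D x)\<^sup>2)"
proof -
  have i1: "set_integrable M S D"
    using integrable_of_square[OF D] S unfolding set_integrable_def by (intro integrable_mult_indicator)
  have i2: "set_integrable M S (\<lambda>x. (D x)\<^sup>2)"
    using D S unfolding set_integrable_def by (intro integrable_mult_indicator)
  have i0: "set_integrable M S (\<lambda>x. a)" for a :: real
    unfolding set_integrable_def using S by (intro integrable_mult_indicator) auto
  define K where "K = (LINT x:S|M. (D x)\<^sup>2)"
  have K0: "0 \<le> K" unfolding K_def set_lebesgue_integral_def by (intro Bochner_Integration.integral_nonneg) auto
  \<comment> \<open>Integrate \<open>(D x - r)\<^sup>2 \<ge> 0\<close> over \<open>S\<close>; the optimal choice is \<open>r = c / measure M S\<close>.\<close>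
  have key: "2 * r * c - r\<^sup>2 * measure M S \<le> K" if "0 \<le> r" for r
  proof -
    have "(LINT x:S|M. 2 * r * D x - r\<^sup>2) \<le> K"
      unfolding K_def
    proof (rule set_integral_mono)
      show "set_integrable M S (\<lambda>x. 2 * r * D x - r\<^sup>2)"
        by (intro set_integral_diff set_integrable_mult_right i0 i1)
      fix x
      have "0 \<le> (D x - r)\<^sup>2" by simp
      then show "2 * r * D x - r\<^sup>2 \<le> (D x)\<^sup>2" by (simp add: power2_eq_square algebra_simps)
    qed (rule i2)
    also have "(LINT x:S|M. 2 * r * D x - r\<^sup>2) = 2 * r * (LINT x:S|M. D x) - r\<^sup>2 * measure M S"
      using S by (subst set_integral_diff)
        (auto intro!: set_integrable_mult_right i0 i1 simp: set_lebesgue_integral_def mult_ac)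
    finally show ?thesis using c that mult_left_mono[of c "LINT x:S|M. D x" "2 * r"] by linarith
  qed
  show pos: "0 < measure M S"
  proof (rule ccontr)
    assume "\<not> ?thesis"
    then have z: "measure M S = 0" using measure_nonneg[of M S] by linarith
    have "2 * (K / c + 1) * c \<le> K" using key[of "K / c + 1"] z c K0 by simp
    moreover have "2 * (K / c + 1) * c = 2 * K + 2 * c" using c by (simp add: field_simps)
    ultimately show False using c K0 by linarith
  qed
  have "2 * (c / measure M S) * c - (c / measure M S)\<^sup>2 * measure M S = c\<^sup>2 / measure M S"
    using pos by (simp add: power2_eq_square field_simps)
  then show "c\<^sup>2 / measure M S \<le> (LINT x:S|M. (D x)\<^sup>2)"
    using key[of "c / measure M S"] pos c unfolding K_def by simp
qed

text \<open>
  Here \<open>f\<close> is the function, \<open>D\<close> plays the role of \<open>\<bar>f'\<bar>\<close>, and the assumption \<open>layer\<close> bounds the variation of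
  \<open>f\<close> across a layer from below. The conclusion is the inequality for functions on \<open>[0, m]\<close> that vanish
  at one end, improved by the factor \<open>k\<^sup>2\<close>.
\<close>

lemma (in finite_measure) superlevel_poincare:
  fixes f D :: "'a \<Rightarrow> real" and k m :: real
  assumes f [measurable]: "f \<in> borel_measurable M"
    and D [measurable]: "D \<in> borel_measurable M" and D2: "integrable M (\<lambda>x. (D x)\<^sup>2)"
    and k: "0 < k" and m: "0 < m" "measure M {x \<in> space M. 0 < f x} \<le> m"
    and y: "y \<in> space M" "\<And>x. x \<in> space M \<Longrightarrow> f x \<le> f y"
    and layer: "\<And>A B. 0 \<le> A \<Longrightarrow> A < B \<Longrightarrow> B \<le> f y \<Longrightarrow>
      k * (B - A) \<le> (LINT x:{x \<in> space M. A < f x \<and> f x \<le> B}|M. D x)"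
  shows "(k * pi / (2 * m))\<^sup>2 * (LINT x:{x \<in> space M. 0 < f x}|M. (f x)\<^sup>2)
    \<le> (LINT x:{x \<in> space M. 0 < f x}|M. (D x)\<^sup>2)"
proof (cases "0 < f y")
  case False
  then have "{x \<in> space M. 0 < f x} = {}" using y(2) by fastforce
  then show ?thesis by (simp add: set_lebesgue_integral_def)
next
  case True
  define T where "T = f y"
  define P where "P = {x \<in> space M. 0 < f x}"
  define I where "I = (LINT x:P|M. (f x)\<^sup>2)"
  define J where "J = (LINT x:P|M. (D x)\<^sup>2)"
  have T: "0 < T" using True by (simp add: T_def)
  have [measurable]: "P \<in> sets M" unfolding P_def by measurable
  \<comment> \<open>Take \<open>n\<close> layers of equal height, and a frequency below \<open>pi / (2 * m)\<close> to stay away from the pole of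
    the tangent. Both restrictions are removed by a limit at the end.\<close>
  have main: "k\<^sup>2 * \<beta>\<^sup>2 * (I - 2 * T\<^sup>2 / real n * m) \<le> J"
    if \<beta>: "0 < \<beta>" "\<beta> * m < pi / 2" and n: "0 < n" for \<beta> :: real and n :: nat
  proof -
    define t where "t i = real i * T / real n" for i
    define S where "S i = {x \<in> space M. t i < f x \<and> f x \<le> t (Suc i)}" for i
    define g where "g i = measure M (S i)" for i
    \<comment> \<open>The layer \<open>S i\<close> corresponds to the interval \<open>[s (Suc i), s i]\<close> of length \<open>g i\<close>, on which the comparison
      function falls from \<open>t (Suc i)\<close> to \<open>t i\<close>.\<close>
    define s where "s i = (\<Sum>j\<in>{i..<n}. g j)" for i
    have [measurable]: "S i \<in> sets M" for i unfolding S_def by measurable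
    have t0: "0 \<le> t i" for i using T by (simp add: t_def)
    have tmono: "i \<le> j \<Longrightarrow> t i \<le> t j" for i j
      using T by (simp add: t_def divide_right_mono mult_right_mono)
    have tdiff: "t (Suc i) - t i = T / real n" for i by (simp add: t_def diff_divide_distrib[symmetric] algebra_simps)
    have tn: "t n = T" using n by (simp add: t_def)
    have disj: "disjoint_family_on S {..<n}"
    proof -
      have "S i \<inter> S j = {}" if "i < j" for i j
        using tmono[of "Suc i" j] that by (fastforce simp: S_def)
      then show ?thesis unfolding disjoint_family_on_def by (metis Int_commute linorder_neqE_nat)
    qed
    have PU: "P = (\<Union>i<n. S i)"
    proof (intro equalityI subsetI)
      fix x assume x: "x \<in> P"
      then have fx: "x \<in> space M" "0 < f x" "f x \<le> t n" using y(2) by (auto simp: P_def tn T_def)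
      define i where "i = (LEAST i. f x \<le> t i)"
      have i: "f x \<le> t i" "i \<le> n" unfolding i_def using fx(3) by (auto intro: LeastI Least_le)
      have "i \<noteq> 0" using i(1) fx(2) by (auto simp: t_def intro!: Nat.gr0I)
      then obtain j where j: "i = Suc j" by (cases i) auto
      have "\<not> f x \<le> t j" using not_less_Least[of j "\<lambda>i. f x \<le> t i"] j by (auto simp: i_def)
      then show "x \<in> (\<Union>i<n. S i)" using i j fx(1) by (auto simp: S_def intro!: bexI[of _ j])
    next
      fix x assume "x \<in> (\<Union>i<n. S i)"
      then obtain i where "x \<in> S i" by auto
      then show "x \<in> P" using t0[of i] by (auto simp: S_def P_def)
    qed
    have split: "(LINT x:P|M. h x) = (\<Sum>i<n. LINT x:S i|M. h x)" if "\<And>i. set_integrable M (S i) h" for h :: "'a \<Rightarrow> real"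
      unfolding PU using disj that by (intro set_integral_finite_Union) auto
    have intD: "set_integrable M (S i) (\<lambda>x. (D x)\<^sup>2)" for i
      unfolding set_integrable_def using D2 by (intro integrable_mult_indicator) auto
    have bound: "(f x)\<^sup>2 \<le> (t (Suc i))\<^sup>2" if "x \<in> S i" for x i
      using that t0[of i] by (intro power_mono) (auto simp: S_def)
    have intf: "set_integrable M (S i) (\<lambda>x. (f x)\<^sup>2)" for i
      unfolding set_integrable_def
      by (rule integrable_const_bound[where B = "(t (Suc i))\<^sup>2"])
         (use bound[of _ i] in \<open>auto simp: indicator_def\<close>)
    have intc: "set_integrable M (S i) (\<lambda>x. c)" for i and c :: real
      unfolding set_integrable_def by (intro integrable_mult_indicator) auto
    have s_Suc: "s i = s (Suc i) + g i" if "i < n" for i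
      unfolding s_def using that by (simp add: sum.atLeast_Suc_lessThan)
    have g0: "0 \<le> g i" for i by (simp add: g_def)
    have s0: "0 \<le> s i" for i unfolding s_def using g0 by (simp add: sum_nonneg)
    have sm: "s 0 \<le> m"
    proof -
      have "s 0 = measure M P"
        unfolding s_def g_def PU using disj by (subst finite_measure_finite_Union) (auto simp: atLeast0LessThan)
      then show ?thesis using m by (simp add: P_def)
    qed
    have sle: "s i \<le> m" for i
    proof -
      have "s i \<le> s 0" unfolding s_def using g0 by (intro sum_mono2) auto
      then show ?thesis using sm by linarith
    qed
    \<comment> \<open>The boundary terms vanish at both ends: \<open>t 0 = 0\<close> and \<open>s n = 0\<close>.\<close>
    define \<Phi> where "\<Phi> i = \<beta> * tan (\<beta> * s i) * (t i)\<^sup>2" for i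
    have piece: "k\<^sup>2 * (\<beta>\<^sup>2 * g i * (t i)\<^sup>2 - \<Phi> i + \<Phi> (Suc i)) \<le> (LINT x:S i|M. (D x)\<^sup>2)" if i: "i < n" for i
    proof -
      have lt: "t i < t (Suc i)" using tdiff[of i] T n by (smt (verit) divide_pos_pos of_nat_0_less_iff)
      have "k * (t (Suc i) - t i) \<le> (LINT x:S i|M. D x)"
        unfolding S_def
      proof (rule layer[OF t0 lt])
        show "t (Suc i) \<le> f y" using tmono[of "Suc i" n] i tn by (simp add: T_def)
      qed
      then have gi: "0 < g i" "(k * (t (Suc i) - t i))\<^sup>2 / g i \<le> (LINT x:S i|M. (D x)\<^sup>2)"
        using layer_energy[of "S i" D "k * (t (Suc i) - t i)"] D2 k lt by (auto simp: g_def)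
      have "\<beta> * s i \<le> \<beta> * m" using sle[of i] \<beta> by simp
      then have "\<beta> * (s (Suc i) + g i) < pi / 2" using \<beta> unfolding s_Suc[OF i] by linarith
      from tangent_layer_bound[OF \<beta>(1) s0 gi(1) this t0 less_imp_le[OF lt]]
      have "\<beta>\<^sup>2 * g i * (t i)\<^sup>2 - \<Phi> i + \<Phi> (Suc i) \<le> (t (Suc i) - t i)\<^sup>2 / g i"
        unfolding \<Phi>_def s_Suc[OF i] by simp
      then have "k\<^sup>2 * (\<beta>\<^sup>2 * g i * (t i)\<^sup>2 - \<Phi> i + \<Phi> (Suc i)) \<le> k\<^sup>2 * ((t (Suc i) - t i)\<^sup>2 / g i)"
        by (intro mult_left_mono) auto
      then show ?thesis using gi(2) by (simp add: power_mult_distrib)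
    qed
    have "(\<Sum>i<n. k\<^sup>2 * (\<beta>\<^sup>2 * g i * (t i)\<^sup>2 - \<Phi> i + \<Phi> (Suc i))) \<le> J"
      unfolding J_def split[OF intD] using piece by (auto intro!: sum_mono)
    moreover have "(\<Sum>i<n. k\<^sup>2 * (\<beta>\<^sup>2 * g i * (t i)\<^sup>2 - \<Phi> i + \<Phi> (Suc i)))
        = k\<^sup>2 * (\<beta>\<^sup>2 * (\<Sum>i<n. g i * (t i)\<^sup>2) + (\<Phi> n - \<Phi> 0))"
      unfolding sum_distrib_left[symmetric] sum_lessThan_telescope[of \<Phi> n, symmetric]
      by (simp add: sum.distrib sum_subtractf sum_distrib_left mult.assoc)
    moreover have "\<Phi> n = 0" "\<Phi> 0 = 0" by (simp_all add: \<Phi>_def s_def t_def)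
    ultimately have low: "k\<^sup>2 * \<beta>\<^sup>2 * (\<Sum>i<n. g i * (t i)\<^sup>2) \<le> J" by (simp add: mult.assoc)
    have "I \<le> (\<Sum>i<n. g i * ((t i)\<^sup>2 + 2 * T\<^sup>2 / real n))"
      unfolding I_def split[OF intf]
    proof (rule sum_mono)
      fix i assume "i \<in> {..<n}"
      then have i: "i < n" by simp
      have "(LINT x:S i|M. (f x)\<^sup>2) \<le> (LINT x:S i|M. (t (Suc i))\<^sup>2)"
        using bound[of _ i] intf intc by (intro set_integral_mono) auto
      also have "\<dots> = g i * (t (Suc i))\<^sup>2" by (simp add: set_lebesgue_integral_def g_def)
      also have "\<dots> \<le> g i * ((t i)\<^sup>2 + 2 * T\<^sup>2 / real n)"
      proof (intro mult_left_mono g0)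
        have "(t (Suc i))\<^sup>2 - (t i)\<^sup>2 = (2 * real i + 1) * (T\<^sup>2 / (real n)\<^sup>2)"
          using n by (simp add: t_def power2_eq_square field_simps)
        also have "\<dots> \<le> (2 * real n) * (T\<^sup>2 / (real n)\<^sup>2)" using i by (intro mult_right_mono) auto
        also have "\<dots> = 2 * T\<^sup>2 / real n" using n by (simp add: power2_eq_square)
        finally show "(t (Suc i))\<^sup>2 \<le> (t i)\<^sup>2 + 2 * T\<^sup>2 / real n" by simp
      qed
      finally show "(LINT x:S i|M. (f x)\<^sup>2) \<le> g i * ((t i)\<^sup>2 + 2 * T\<^sup>2 / real n)" .
    qed
    also have "\<dots> = (\<Sum>i<n. g i * (t i)\<^sup>2) + 2 * T\<^sup>2 / real n * s 0"
      by (simp only: distrib_left sum.distrib sum_distrib_right[symmetric] s_def atLeast0LessThan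
          mult.commute[of "2 * T\<^sup>2 / real n"])
    also have "\<dots> \<le> (\<Sum>i<n. g i * (t i)\<^sup>2) + 2 * T\<^sup>2 / real n * m"
      using sm by (intro add_left_mono mult_left_mono) auto
    finally have "I - 2 * T\<^sup>2 / real n * m \<le> (\<Sum>i<n. g i * (t i)\<^sup>2)" by linarith
    then have "k\<^sup>2 * \<beta>\<^sup>2 * (I - 2 * T\<^sup>2 / real n * m) \<le> k\<^sup>2 * \<beta>\<^sup>2 * (\<Sum>i<n. g i * (t i)\<^sup>2)"
      by (intro mult_left_mono) auto
    then show ?thesis using low by linarith
  qed
  define \<beta> where "\<beta> n = pi / (2 * m) * (1 - 1 / real n)" for n :: nat
  have "(\<lambda>n. k\<^sup>2 * (\<beta> n)\<^sup>2 * (I - 2 * T\<^sup>2 / real n * m)) \<longlonglongrightarrow> k\<^sup>2 * (pi / (2 * m) * (1 - 0))\<^sup>2 * (I - 0 * m)"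
    unfolding \<beta>_def by (intro tendsto_intros lim_const_over_n lim_1_over_n)
  moreover have "\<exists>N. \<forall>n\<ge>N. k\<^sup>2 * (\<beta> n)\<^sup>2 * (I - 2 * T\<^sup>2 / real n * m) \<le> J"
  proof (intro exI[of _ 2] allI impI)
    fix n :: nat assume n: "2 \<le> n"
    have "0 < 1 - 1 / real n" "1 - 1 / real n < 1" using n by auto
    moreover have "\<beta> n * m = pi / 2 * (1 - 1 / real n)" using m by (simp add: \<beta>_def)
    ultimately show "k\<^sup>2 * (\<beta> n)\<^sup>2 * (I - 2 * T\<^sup>2 / real n * m) \<le> J"
      using n m by (intro main) (auto simp: \<beta>_def)
  qed
  ultimately have "k\<^sup>2 * (pi / (2 * m) * (1 - 0))\<^sup>2 * (I - 0 * m) \<le> J" by (rule LIMSEQ_le_const2)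
  then show ?thesis by (simp add: I_def J_def P_def power_mult_distrib power_divide)
qed

lemma (in finite_measure) exists_median:
  fixes f :: "'a \<Rightarrow> real"
  assumes f [measurable]: "f \<in> borel_measurable M" and pos: "0 < measure M (space M)"
    and bounded: "p \<in> space M" "q \<in> space M" "\<And>x. x \<in> space M \<Longrightarrow> f p \<le> f x \<and> f x \<le> f q"
  obtains a where "measure M {x \<in> space M. a < f x} \<le> measure M (space M) / 2"
    and "measure M {x \<in> space M. f x < a} \<le> measure M (space M) / 2"
proof -
  define X where "X = {t. measure M {x \<in> space M. t < f x} \<le> measure M (space M) / 2}"
  have up: "t' \<in> X" if "t \<in> X" "t \<le> t'" for t t'
  proof -
    have "measure M {x \<in> space M. t' < f x} \<le> measure M {x \<in> space M. t < f x}"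
      using that by (intro finite_measure_mono) auto
    then show ?thesis using that by (simp add: X_def)
  qed
  have empty: "{x \<in> space M. f q < f x} = {}" using bounded(3) by fastforce
  have "f q \<in> X" unfolding X_def mem_Collect_eq empty using pos by simp
  then have ne: "X \<noteq> {}" by auto
  have bdd: "bdd_below X"
  proof (rule bdd_belowI[of _ "f p"], rule ccontr)
    fix t assume t: "t \<in> X" "\<not> f p \<le> t"
    then have "{x \<in> space M. t < f x} = space M" using bounded(3) by fastforce
    then show False using t(1) pos by (simp add: X_def)
  qed
  define a where "a = Inf X"
  have above: "t \<in> X" if "a < t" for t
    using cInf_lessD[OF ne] that up unfolding a_def by (meson less_imp_le)
  have below: "t \<notin> X" if "t < a" for t
    using cInf_lower[OF _ bdd, of t] that by (auto simp: a_def)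
  have lim: "measure M U \<le> measure M (space M) / 2"
    if "\<And>n. V n \<in> sets M" "incseq V" "U = (\<Union>n. V n)" "\<And>n. measure M (V n) \<le> measure M (space M) / 2"
    for U and V :: "nat \<Rightarrow> 'a set"
    using finite_Lim_measure_incseq[of V] that by (intro LIMSEQ_le_const2[of "\<lambda>n. measure M (V n)"]) auto
  have inv: "1 / real (Suc n') \<le> 1 / real (Suc n)" if "n \<le> n'" for n n' :: nat
    using that by (simp add: frac_le)
  show ?thesis
  proof
    show "measure M {x \<in> space M. a < f x} \<le> measure M (space M) / 2"
    proof (rule lim)
      fix n :: nat
      show "measure M {x \<in> space M. a + 1 / real (Suc n) < f x} \<le> measure M (space M) / 2"
        using above[of "a + 1 / real (Suc n)"] by (simp add: X_def)
    next
      show "incseq (\<lambda>n. {x \<in> space M. a + 1 / real (Suc n) < f x})"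
        unfolding incseq_def using inv by (force intro: le_less_trans[OF add_left_mono])
    next
      have "\<exists>n. a + 1 / real (Suc n) < f x" if "a < f x" for x
        using reals_Archimedean[of "f x - a"] that by (auto simp: inverse_eq_divide algebra_simps)
      moreover have "a < f x" if "a + 1 / real (Suc n) < f x" for x n
        using that by (smt (verit) divide_nonneg_nonneg of_nat_0_le_iff)
      ultimately show "{x \<in> space M. a < f x} = (\<Union>n. {x \<in> space M. a + 1 / real (Suc n) < f x})" by auto
    qed measurable
    show "measure M {x \<in> space M. f x < a} \<le> measure M (space M) / 2"
    proof (rule lim)
      fix n :: nat
      have "a - 1 / real (Suc n) \<notin> X" by (intro below) simp
      then have "measure M (space M) / 2 < measure M {x \<in> space M. a - 1 / real (Suc n) < f x}"
        by (simp add: X_def)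
      moreover have "measure M {x \<in> space M. f x \<le> a - 1 / real (Suc n)}
          = measure M (space M) - measure M {x \<in> space M. a - 1 / real (Suc n) < f x}"
        by (subst finite_measure_compl[symmetric]) (auto intro!: arg_cong[where f = "measure M"])
      ultimately show "measure M {x \<in> space M. f x \<le> a - 1 / real (Suc n)} \<le> measure M (space M) / 2"
        by linarith
    next
      show "incseq (\<lambda>n. {x \<in> space M. f x \<le> a - 1 / real (Suc n)})"
        unfolding incseq_def using inv by (force intro: order_trans[OF _ diff_left_mono])
    next
      have "\<exists>n. f x \<le> a - 1 / real (Suc n)" if "f x < a" for x
        using reals_Archimedean[of "a - f x"] that
        by (auto simp: inverse_eq_divide algebra_simps intro: less_imp_le)
      moreover have "f x < a" if "f x \<le> a - 1 / real (Suc n)" for x n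
        using that by (smt (verit) divide_pos_pos of_nat_0_less_iff zero_less_Suc)
      ultimately show "{x \<in> space M. f x < a} = (\<Union>n. {x \<in> space M. f x \<le> a - 1 / real (Suc n)})" by auto
    qed measurable
  qed
qed

text \<open>
  For an absolutely continuous \<open>f\<close> on an interval of length \<open>\<mu> = measure M (space M)\<close>, the assumption
  \<open>layer\<close> holds with \<open>k = 1\<close> and \<open>D = \<bar>f'\<bar>\<close>; the constant \<open>(pi / \<mu>)\<^sup>2\<close> is then the first nonzero eigenvalue of the Neumann Laplacian.
\<close>

theorem (in finite_measure) mean_zero_poincare:
  fixes f D :: "'a \<Rightarrow> real" and k :: real
  assumes f [measurable]: "f \<in> borel_measurable M" and D [measurable]: "D \<in> borel_measurable M"
    and D0: "\<And>x. x \<in> space M \<Longrightarrow> 0 \<le> D x" and D2: "integrable M (\<lambda>x. (D x)\<^sup>2)"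
    and k: "0 < k" and pos: "0 < measure M (space M)"
    and bounded: "p \<in> space M" "q \<in> space M" "\<And>x. x \<in> space M \<Longrightarrow> f p \<le> f x \<and> f x \<le> f q"
    and layer: "\<And>A B. f p \<le> A \<Longrightarrow> A < B \<Longrightarrow> B \<le> f q \<Longrightarrow>
      k * (B - A) \<le> (LINT x:{x \<in> space M. A < f x \<and> f x < B}|M. D x)"
    and mean: "(LINT x|M. f x) = 0"
  shows "(k * pi / measure M (space M))\<^sup>2 * (LINT x|M. (f x)\<^sup>2) \<le> (LINT x|M. (D x)\<^sup>2)"
proof -
  define m where "m = measure M (space M)"
  have m: "0 < m" using pos by (simp add: m_def)
  obtain a where a: "measure M {x \<in> space M. a < f x} \<le> m / 2" "measure M {x \<in> space M. f x < a} \<le> m / 2"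
    using exists_median[OF f pos bounded] unfolding m_def by blast
  have pa: "f p \<le> a"
  proof (rule ccontr)
    assume "\<not> ?thesis"
    then have "{x \<in> space M. a < f x} = space M" using bounded(3) by fastforce
    then show False using a m by (simp add: m_def)
  qed
  have qa: "a \<le> f q"
  proof (rule ccontr)
    assume "\<not> ?thesis"
    then have "{x \<in> space M. f x < a} = space M" using bounded(3) by fastforce
    then show False using a m by (simp add: m_def)
  qed
  have iD: "integrable M D" by (rule integrable_of_square[OF D D2])
  have mono: "(LINT x:S|M. D x) \<le> (LINT x:S'|M. D x)"
    if "S \<subseteq> S'" "S \<in> sets M" "S' \<in> sets M" for S S'
    unfolding set_lebesgue_integral_def using that D0 iD sets.sets_into_space[OF that(3)]
    by (intro integral_mono integrable_mult_indicator) (auto simp: indicator_def)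
  have bd2: "\<bar>f x\<bar> \<le> \<bar>f p\<bar> + \<bar>f q\<bar>" if "x \<in> space M" for x
    using bounded(3)[OF that] by linarith
  have fb: "integrable M (\<lambda>x. f x)"
    by (rule integrable_const_bound[where B = "\<bar>f p\<bar> + \<bar>f q\<bar>"]) (auto intro!: AE_I2 bd2)
  have fb2: "integrable M (\<lambda>x. (f x)\<^sup>2)"
    by (intro integrable_const_bound[where B = "(\<bar>f p\<bar> + \<bar>f q\<bar>)\<^sup>2"])
      (auto intro!: AE_I2 intro: order_trans[OF bd2] simp: abs_le_square_iff[symmetric])
  have sq: "(\<lambda>x. (f x - a)\<^sup>2) = (\<lambda>x. (f x)\<^sup>2 - 2 * a * f x + a\<^sup>2)"
    by (simp add: power2_eq_square algebra_simps fun_eq_iff)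
  have ia: "integrable M (\<lambda>x. (f x - a)\<^sup>2)" unfolding sq using fb fb2 by simp
  have up: "(k * pi / m)\<^sup>2 * (LINT x:{x \<in> space M. a < f x}|M. (f x - a)\<^sup>2)
      \<le> (LINT x:{x \<in> space M. a < f x}|M. (D x)\<^sup>2)"
  proof -
    have "(k * pi / (2 * (m / 2)))\<^sup>2 * (LINT x:{x \<in> space M. 0 < f x - a}|M. (f x - a)\<^sup>2)
      \<le> (LINT x:{x \<in> space M. 0 < f x - a}|M. (D x)\<^sup>2)"
    proof (rule superlevel_poincare[where y = q])
      fix A B :: real assume AB: "0 \<le> A" "A < B" "B \<le> f q - a"
      have "k * (B - A) = k * ((a + B) - (a + A))" by simp
      also have "\<dots> \<le> (LINT x:{x \<in> space M. a + A < f x \<and> f x < a + B}|M. D x)"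
        using AB pa by (intro layer) auto
      also have "\<dots> \<le> (LINT x:{x \<in> space M. A < f x - a \<and> f x - a \<le> B}|M. D x)"
        by (rule mono) auto
      finally show "k * (B - A) \<le> (LINT x:{x \<in> space M. A < f x - a \<and> f x - a \<le> B}|M. D x)" .
    qed (use a D2 k m bounded in auto)
    then show ?thesis by simp
  qed
  have low: "(k * pi / m)\<^sup>2 * (LINT x:{x \<in> space M. f x < a}|M. (f x - a)\<^sup>2)
      \<le> (LINT x:{x \<in> space M. f x < a}|M. (D x)\<^sup>2)"
  proof -
    have "(k * pi / (2 * (m / 2)))\<^sup>2 * (LINT x:{x \<in> space M. 0 < a - f x}|M. (a - f x)\<^sup>2)
      \<le> (LINT x:{x \<in> space M. 0 < a - f x}|M. (D x)\<^sup>2)"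
    proof (rule superlevel_poincare[where y = p])
      fix A B :: real assume AB: "0 \<le> A" "A < B" "B \<le> a - f p"
      have "k * (B - A) = k * ((a - A) - (a - B))" by simp
      also have "\<dots> \<le> (LINT x:{x \<in> space M. a - B < f x \<and> f x < a - A}|M. D x)"
        using AB qa by (intro layer) auto
      also have "\<dots> \<le> (LINT x:{x \<in> space M. A < a - f x \<and> a - f x \<le> B}|M. D x)"
        by (rule mono) auto
      finally show "k * (B - A) \<le> (LINT x:{x \<in> space M. A < a - f x \<and> a - f x \<le> B}|M. D x)" .
    qed (use a D2 k m bounded in auto)
    then show ?thesis by (simp add: power2_commute[of a])
  qed
  have si: "set_integrable M S h" if "integrable M h" "S \<in> sets M" for h :: "'a \<Rightarrow> real" and S
    unfolding set_integrable_def using that by (intro integrable_mult_indicator)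
  \<comment> \<open>As \<open>f\<close> has mean zero, the difference of the two sides is \<open>a\<^sup>2\<close> times the total mass.\<close>
  have "(LINT x|M. (f x)\<^sup>2) \<le> (LINT x|M. (f x - a)\<^sup>2)"
    unfolding sq using fb fb2 mean by simp
  also have "\<dots> = (LINT x|M. indicator {x \<in> space M. a < f x} x *\<^sub>R (f x - a)\<^sup>2 + indicator {x \<in> space M. f x < a} x *\<^sub>R (f x - a)\<^sup>2)"
    by (intro Bochner_Integration.integral_cong) (auto simp: indicator_def)
  also have "\<dots> = (LINT x:{x \<in> space M. a < f x}|M. (f x - a)\<^sup>2) + (LINT x:{x \<in> space M. f x < a}|M. (f x - a)\<^sup>2)"
    unfolding set_lebesgue_integral_def
    by (intro Bochner_Integration.integral_add si[OF ia, unfolded set_integrable_def]) measurable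
  finally have "(k * pi / m)\<^sup>2 * (LINT x|M. (f x)\<^sup>2)
      \<le> (k * pi / m)\<^sup>2 * ((LINT x:{x \<in> space M. a < f x}|M. (f x - a)\<^sup>2) + (LINT x:{x \<in> space M. f x < a}|M. (f x - a)\<^sup>2))"
    by (intro mult_left_mono) auto
  also have "\<dots> \<le> (LINT x:{x \<in> space M. a < f x}|M. (D x)\<^sup>2) + (LINT x:{x \<in> space M. f x < a}|M. (D x)\<^sup>2)"
    using up low by (simp add: distrib_left)
  also have "\<dots> = (LINT x|M. indicator {x \<in> space M. a < f x} x *\<^sub>R (D x)\<^sup>2 + indicator {x \<in> space M. f x < a} x *\<^sub>R (D x)\<^sup>2)"
    unfolding set_lebesgue_integral_def
    by (intro Bochner_Integration.integral_add[symmetric] si[OF D2, unfolded set_integrable_def]) measurable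
  also have "\<dots> \<le> (LINT x|M. (D x)\<^sup>2)"
    using D2 by (intro integral_mono Bochner_Integration.integrable_add si[OF D2, unfolded set_integrable_def])
      (auto simp: indicator_def)
  finally show ?thesis by (simp add: m_def)
qed

section \<open>Edge cuts and cycle coverings\<close>

text \<open>
  The distance \<open>\<bar>a j - b j\<bar>\<close> is the measure of the set of levels \<open>t\<close> that separate \<open>a j\<close> from \<open>b j\<close>.
\<close>

lemma sum_abs_diff_ge_crossings:
  fixes a b :: "'j \<Rightarrow> real" and A B :: real and k :: nat
  assumes fin: "finite J" and AB: "A \<le> B"
    and cross: "\<And>t. A \<le> t \<Longrightarrow> t < B \<Longrightarrow> k \<le> card {j \<in> J. (a j \<le> t) \<noteq> (b j \<le> t)}"
  shows "real k * (B - A) \<le> (\<Sum>j\<in>J. \<bar>a j - b j\<bar>)"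
proof -
  have int: "integrable lborel (\<lambda>t. indicator {c..<d} t :: real)" for c d :: real
    by (intro integrable_real_indicator emeasure_bounded_finite) auto
  have cr: "(a j \<le> t) \<noteq> (b j \<le> t) \<longleftrightarrow> t \<in> {min (a j) (b j)..<max (a j) (b j)}" for j t by auto
  have "real k * (B - A) = (LINT t|lborel. real k * indicator {A..<B} t)"
    using AB by simp
  also have "\<dots> \<le> (LINT t|lborel. (\<Sum>j\<in>J. indicator {min (a j) (b j)..<max (a j) (b j)} t))"
  proof (rule integral_mono)
    fix t :: real
    have "real (card {j \<in> J. (a j \<le> t) \<noteq> (b j \<le> t)}) = (\<Sum>j\<in>J. indicator {min (a j) (b j)..<max (a j) (b j)} t)"
      unfolding cr by (simp add: fin indicator_def sum.If_cases Int_def)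
    then show "real k * indicator {A..<B} t \<le> (\<Sum>j\<in>J. indicator {min (a j) (b j)..<max (a j) (b j)} t)"
      using cross[of t] by (cases "t \<in> {A..<B}") (auto simp flip: of_nat_le_iff simp: sum_nonneg)
  qed (intro int Bochner_Integration.integrable_sum integrable_mult_right)+
  also have "\<dots> = (\<Sum>j\<in>J. \<bar>a j - b j\<bar>)"
    by (subst Bochner_Integration.integral_sum[OF int]) (auto intro!: sum.cong simp: abs_real_def)
  finally show ?thesis .
qed

text \<open>
  The edges with exactly one end in \<open>S\<close>; their direction is ignored.
\<close>

definition edge_cut :: "('v, 'e) pre_digraph \<Rightarrow> 'v set \<Rightarrow> 'e set" where
  "edge_cut G S = {e \<in> arcs G. (tail G e \<in> S) \<noteq> (head G e \<in> S)}"

text \<open>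
  Every cut that separates the vertex set into two nonempty parts has at least \<open>k\<close> edges, i.e. the
  underlying undirected multigraph is \<open>k\<close>-edge-connected. For a single vertex the condition is void.
\<close>

definition edge_connectivity_ge :: "('v, 'e) pre_digraph \<Rightarrow> nat \<Rightarrow> bool" where
  "edge_connectivity_ge G k \<longleftrightarrow>
     (\<forall>S. S \<inter> verts G \<noteq> {} \<longrightarrow> verts G - S \<noteq> {} \<longrightarrow> k \<le> card (edge_cut G S))"

lemma connected_edge_cut_nonempty:
  assumes "wf_digraph G" and conn: "Digraph_Component.connected G"
    and u: "u \<in> verts G" "u \<in> S" and v: "v \<in> verts G" "v \<notin> S"
  shows "edge_cut G S \<noteq> {}"
proof
  assume none: "edge_cut G S = {}"
  interpret wf_digraph G by fact
  have "(u, v) \<in> rtrancl_on (verts G) ((arcs_ends G)\<^sup>s)" using conn u v by (simp add: connected_conv)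
  then have "v \<in> S"
  proof (induction rule: rtrancl_on_induct)
    case (step x y)
    then obtain e where "e \<in> arcs G" "(tail G e = x \<and> head G e = y) \<or> (tail G e = y \<and> head G e = x)"
      by (auto simp: symcl_def arcs_ends_def arc_to_ends_def)
    with none step show ?case by (auto simp: edge_cut_def)
  qed (use u in auto)
  with v show False by simp
qed

lemma connected_edge_connectivity:
  assumes "fin_digraph G" and "Digraph_Component.connected G"
  shows "edge_connectivity_ge G 1"
  unfolding edge_connectivity_ge_def
proof (intro allI impI)
  interpret fin_digraph G by fact
  fix S assume "S \<inter> verts G \<noteq> {}" "verts G - S \<noteq> {}"
  then have "edge_cut G S \<noteq> {}"
    using connected_edge_cut_nonempty[OF wf_digraph_axioms assms(2)] by blast
  moreover have "finite (edge_cut G S)" by (simp add: edge_cut_def)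
  ultimately show "1 \<le> card (edge_cut G S)" by (simp add: Suc_le_eq card_gt_0_iff)
qed

text \<open>
  A walk changes sides of a cut exactly when it traverses an edge of the cut.
\<close>

lemma walk_cut_parity:
  assumes "pre_digraph.cas (both_directions G) u p v"
  shows "even (length (filter (\<lambda>(e, b). (tail G e \<in> S) \<noteq> (head G e \<in> S)) p)) \<longleftrightarrow> (u \<in> S \<longleftrightarrow> v \<in> S)"
  using assms
proof (induction p arbitrary: u)
  case Nil
  then show ?case by (simp add: pre_digraph.cas.simps)
next
  case (Cons a p)
  obtain e b where a: "a = (e, b)" by force
  have u: "u = (if b then tail G e else head G e)"
    and p: "pre_digraph.cas (both_directions G) (if b then head G e else tail G e) p v"
    using Cons.prems by (auto simp: pre_digraph.cas.simps both_directions_def a split: if_splits)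
  show ?case using Cons.IH[OF p] unfolding u a by (cases b) auto
qed

lemma cycle_covering_edge_connectivity:
  assumes "fin_digraph G" and "Digraph_Component.connected G" and cover: "admits_cycle_covering G"
  shows "edge_connectivity_ge G 2"
  unfolding edge_connectivity_ge_def
proof (intro allI impI)
  interpret fin_digraph G by fact
  fix S assume S: "S \<inter> verts G \<noteq> {}" "verts G - S \<noteq> {}"
  obtain e where e: "e \<in> edge_cut G S"
    using S connected_edge_cut_nonempty[OF wf_digraph_axioms assms(2)] by blast
  then obtain p v where p: "distinct (map fst p)" "pre_digraph.awalk (both_directions G) v p v" "e \<in> fst ` set p"
    using cover by (fastforce simp: edge_cut_def admits_cycle_covering_def graph_cycle_def)
  have cas: "pre_digraph.cas (both_directions G) v p v" and sub: "set p \<subseteq> arcs G \<times> UNIV"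
    using p(2) by (auto simp: pre_digraph.awalk_def both_directions_def)
  define q where "q = filter (\<lambda>(e, b). (tail G e \<in> S) \<noteq> (head G e \<in> S)) p"
  have "even (length q)" using walk_cut_parity[OF cas] by (simp add: q_def)
  moreover have "q \<noteq> []" using p(3) e by (force simp: q_def filter_empty_conv edge_cut_def)
  ultimately have "2 \<le> length q" by (cases q) (auto elim!: oddE simp: Suc_le_eq)
  moreover have "card (fst ` set q) = length q"
  proof -
    have "distinct (map fst q)" using p(1) unfolding q_def by (rule distinct_map_filter)
    then show ?thesis by (metis distinct_card length_map list.set_map)
  qed
  moreover have "card (fst ` set q) \<le> card (edge_cut G S)"
    by (rule card_mono) (use sub in \<open>auto simp: edge_cut_def q_def\<close>)
  ultimately show "2 \<le> card (edge_cut G S)" by linarith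
qed

section \<open>Weak derivatives control increments\<close>

lemma truncated_square_deriv:
  "((\<lambda>z::real. (max 0 z)\<^sup>2) has_real_derivative 2 * max 0 z) (at z)"
proof -
  consider "0 < z" | "z < 0" | "z = 0" by linarith
  then show ?thesis
  proof cases
    case 1
    have "((\<lambda>z. z\<^sup>2) has_real_derivative 2 * max 0 z) (at z)"
      using 1 by (auto intro!: derivative_eq_intros)
    then show ?thesis
      by (rule has_field_derivative_transform_within_open[where S = "{0<..}"]) (use 1 in auto)
  next
    case 2
    have "((\<lambda>z. 0) has_real_derivative 2 * max 0 z) (at z)"
      using 2 by (auto intro!: derivative_eq_intros)
    then show ?thesis
      by (rule has_field_derivative_transform_within_open[where S = "{..<0}"]) (use 2 in auto)
  next
    case 3
    have "((\<lambda>h::real. (max 0 h)\<^sup>2 / h) \<longlongrightarrow> 0) (at 0)"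
    proof (rule Lim_null_comparison)
      show "\<forall>\<^sub>F h in at 0. norm ((max 0 h)\<^sup>2 / h) \<le> \<bar>h\<bar>"
        by (auto simp: eventually_at_filter max_def power2_eq_square)
      show "((\<lambda>h::real. \<bar>h\<bar>) \<longlongrightarrow> 0) (at 0)" by (rule tendsto_rabs_zero) simp
    qed
    then show ?thesis by (simp add: 3 DERIV_def)
  qed
qed

text \<open>
  A quadratic spline that rises from 0 to 1 on \<open>[0, 1]\<close> and is constant outside, and its continuous
  derivative, a hat function with integral 1.
\<close>

definition smooth_step :: "real \<Rightarrow> real" where
  "smooth_step z = 2 * ((max 0 z)\<^sup>2 - 2 * (max 0 (z - 1 / 2))\<^sup>2 + (max 0 (z - 1))\<^sup>2)"

definition hat :: "real \<Rightarrow> real" where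
  "hat z = 4 * (max 0 z - 2 * max 0 (z - 1 / 2) + max 0 (z - 1))"

lemma smooth_step_deriv [derivative_intros]:
  assumes "(g has_real_derivative g') (at z)"
  shows "((\<lambda>z. smooth_step (g z)) has_real_derivative hat (g z) * g') (at z)"
proof -
  have sq: "((\<lambda>z. (max 0 (z - c))\<^sup>2) has_real_derivative 2 * max 0 (z - c)) (at z)" for c z :: real
  proof -
    have "((\<lambda>z. z - c) has_real_derivative 1) (at z)" by (auto intro!: derivative_eq_intros)
    from DERIV_chain2[OF truncated_square_deriv this] show ?thesis by simp
  qed
  have "(smooth_step has_real_derivative hat z) (at z)" for z
    using DERIV_cmult[OF DERIV_add[OF DERIV_diff[OF sq[of 0] DERIV_cmult[OF sq[of "1 / 2"], of 2]] sq[of 1]], of 2 z]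
    unfolding smooth_step_def[abs_def] hat_def by (simp add: algebra_simps)
  from DERIV_chain'[OF assms this] show ?thesis by (simp add: mult.commute)
qed

lemma hat_nonneg: "0 \<le> hat z"
  by (simp add: hat_def max_def)

lemma hat_eq_0: "z \<le> 0 \<or> 1 \<le> z \<Longrightarrow> hat z = 0"
  by (auto simp: hat_def max_def)

lemma continuous_on_hat [continuous_intros]:
  "continuous_on S g \<Longrightarrow> continuous_on S (\<lambda>z. hat (g z))"
  unfolding hat_def by (intro continuous_intros)

lemma smooth_step_eq_0: "z \<le> 0 \<Longrightarrow> smooth_step z = 0"
  by (simp add: smooth_step_def)

lemma smooth_step_eq_1: "1 \<le> z \<Longrightarrow> smooth_step z = 1"
  by (simp add: smooth_step_def power2_eq_square algebra_simps max_def)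

lemma smooth_step_mono: "z \<le> z' \<Longrightarrow> smooth_step z \<le> smooth_step z'"
  by (rule DERIV_nonneg_imp_nondecreasing)
    (use smooth_step_deriv[OF DERIV_ident] hat_nonneg in force)+

lemma smooth_step_bounds: "0 \<le> smooth_step z" "smooth_step z \<le> 1"
  using smooth_step_mono[of "min 0 z" z] smooth_step_mono[of z "max 1 z"]
  by (auto simp: smooth_step_eq_0 smooth_step_eq_1)

text \<open>
  The hat functions rescaled to \<open>[a, a + \<delta>]\<close> are averaging kernels.
\<close>

lemma hat_average:
  fixes w :: "real \<Rightarrow> real"
  assumes cont: "continuous_on {0..l} w" and \<delta>: "0 < \<delta>" and a: "0 \<le> a" "a + \<delta> \<le> l"
    and close: "\<And>z. a \<le> z \<Longrightarrow> z \<le> a + \<delta> \<Longrightarrow> \<bar>w z - c\<bar> \<le> \<epsilon>"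
  shows "\<bar>(LINT z|lebesgue_on {0..l}. w z * (hat ((z - a) / \<delta>) / \<delta>)) - c\<bar> \<le> \<epsilon>"
proof -
  define \<rho> where "\<rho> z = hat ((z - a) / \<delta>) / \<delta>" for z
  have \<rho>c: "continuous_on {0..l} \<rho>" unfolding \<rho>_def using \<delta> by (intro continuous_intros) auto
  have \<rho>0: "0 \<le> \<rho> z" for z using \<delta> by (simp add: \<rho>_def hat_nonneg)
  have int: "integrable (lebesgue_on {0..l}) h" if "continuous_on {0..l} h" for h :: "real \<Rightarrow> real"
    using that by (rule continuous_imp_integrable_real)
  have "(\<rho> has_integral smooth_step ((l - a) / \<delta>) - smooth_step ((0 - a) / \<delta>)) {0..l}"
  proof (rule fundamental_theorem_of_calculus)
    fix z assume "z \<in> {0..l}"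
    have "((\<lambda>z. smooth_step ((z - a) / \<delta>)) has_real_derivative \<rho> z) (at z)"
      unfolding \<rho>_def using \<delta> by (auto intro!: derivative_eq_intros)
    then show "((\<lambda>z. smooth_step ((z - a) / \<delta>)) has_vector_derivative \<rho> z) (at z within {0..l})"
      by (simp add: has_real_derivative_iff_has_vector_derivative has_vector_derivative_at_within)
  qed (use a \<delta> in auto)
  moreover have "smooth_step ((l - a) / \<delta>) = 1" using a \<delta> by (intro smooth_step_eq_1) (simp add: field_simps)
  moreover have "smooth_step ((0 - a) / \<delta>) = 0" using a \<delta> by (intro smooth_step_eq_0) (simp add: field_simps)
  ultimately have mass: "(LINT z|lebesgue_on {0..l}. \<rho> z) = 1"
    using lebesgue_integral_eq_integral[OF int[OF \<rho>c]] by (simp add: integral_unique)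
  have "(LINT z|lebesgue_on {0..l}. w z * \<rho> z) - c = (LINT z|lebesgue_on {0..l}. w z * \<rho> z) - c * (LINT z|lebesgue_on {0..l}. \<rho> z)"
    by (simp add: mass)
  also have "\<dots> = (LINT z|lebesgue_on {0..l}. w z * \<rho> z - c * \<rho> z)"
    by (subst Bochner_Integration.integral_diff) (auto intro!: int continuous_intros cont \<rho>c)
  also have "\<bar>\<dots>\<bar> \<le> (LINT z|lebesgue_on {0..l}. \<epsilon> * \<rho> z)"
  proof (rule order_trans[OF integral_abs_bound integral_mono])
    fix z
    show "\<bar>w z * \<rho> z - c * \<rho> z\<bar> \<le> \<epsilon> * \<rho> z"
    proof (cases "a \<le> z \<and> z \<le> a + \<delta>")
      case True
      then have "\<bar>w z - c\<bar> * \<rho> z \<le> \<epsilon> * \<rho> z" using close \<rho>0 by (intro mult_right_mono) auto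
      moreover have "\<bar>w z * \<rho> z - c * \<rho> z\<bar> = \<bar>w z - c\<bar> * \<rho> z"
        using \<rho>0[of z] by (simp add: left_diff_distrib[symmetric] abs_mult)
      ultimately show ?thesis by simp
    next
      case False
      then have "\<rho> z = 0" using \<delta> by (auto simp: \<rho>_def field_simps intro!: hat_eq_0)
      then show ?thesis by simp
    qed
  qed (auto intro!: int continuous_intros cont \<rho>c)
  finally have "\<bar>(LINT z|lebesgue_on {0..l}. w z * \<rho> z) - c\<bar> \<le> \<epsilon>"
    unfolding integral_mult_right_zero mass by simp
  then show ?thesis unfolding \<rho>_def .
qed

text \<open>
  The test function is a smoothed indicator of \<open>[y, x]\<close>: it rises from 0 to 1 on \<open>[y, y + \<delta>]\<close> and falls
  back on \<open>[x - \<delta>, x]\<close>. Up to sign, integrating \<open>w\<close> against its derivative gives the difference of the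
  averages of \<open>w\<close> over these two intervals, which tends to \<open>w x - w y\<close> as \<open>\<delta>\<close> tends to 0.
\<close>

lemma weak_derivative_increment_interior:
  fixes w h :: "real \<Rightarrow> real"
  assumes cont: "continuous_on {0..l} w" and h: "integrable (lebesgue_on {0..l}) h"
    and weak: "\<And>\<phi>. test_function l \<phi> \<Longrightarrow>
      (LINT z|lebesgue_on {0..l}. w z * deriv \<phi> z) = - (LINT z|lebesgue_on {0..l}. h z * \<phi> z)"
    and yx: "0 < y" "y < x" "x < l"
  shows "\<bar>w x - w y\<bar> \<le> (LINT z:{y<..<x}|lebesgue_on {0..l}. \<bar>h z\<bar>)"
proof (rule field_le_epsilon)
  fix \<epsilon> :: real assume "0 < \<epsilon>"
  then have \<epsilon>: "0 < \<epsilon> / 2" by simp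
  obtain dy where dy: "0 < dy" "\<And>z. z \<in> {0..l} \<Longrightarrow> \<bar>z - y\<bar> < dy \<Longrightarrow> \<bar>w z - w y\<bar> \<le> \<epsilon> / 2"
    using cont[unfolded continuous_on_iff, rule_format, of y "\<epsilon> / 2"] \<epsilon> yx by (force simp: dist_real_def)
  obtain dx where dx: "0 < dx" "\<And>z. z \<in> {0..l} \<Longrightarrow> \<bar>z - x\<bar> < dx \<Longrightarrow> \<bar>w z - w x\<bar> \<le> \<epsilon> / 2"
    using cont[unfolded continuous_on_iff, rule_format, of x "\<epsilon> / 2"] \<epsilon> yx by (force simp: dist_real_def)
  define \<delta> where "\<delta> = min (min (dy / 2) (dx / 2)) (x - y)"
  have \<delta>: "0 < \<delta>" "\<delta> < dy" "\<delta> < dx" "y \<le> x - \<delta>"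
    using dy(1) dx(1) yx by (auto simp: \<delta>_def)
  define \<phi> where "\<phi> z = smooth_step ((z - y) / \<delta>) - smooth_step ((z - (x - \<delta>)) / \<delta>)" for z
  define \<phi>' where "\<phi>' z = hat ((z - y) / \<delta>) / \<delta> - hat ((z - (x - \<delta>)) / \<delta>) / \<delta>" for z
  have deriv: "(\<phi> has_real_derivative \<phi>' z) (at z)" for z
    unfolding \<phi>_def \<phi>'_def using \<delta> by (auto intro!: derivative_eq_intros)
  then have deriv_eq: "deriv \<phi> = \<phi>'" by (auto simp: fun_eq_iff intro: DERIV_imp_deriv)
  have outside: "\<phi> z = 0" if "z \<le> y \<or> x \<le> z" for z
    using that
  proof
    assume "z \<le> y"
    then have "(z - y) / \<delta> \<le> 0" "(z - (x - \<delta>)) / \<delta> \<le> 0" using \<delta> by (auto simp: field_simps)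
    then show ?thesis by (simp add: \<phi>_def smooth_step_eq_0)
  next
    assume "x \<le> z"
    then have "1 \<le> (z - y) / \<delta>" "1 \<le> (z - (x - \<delta>)) / \<delta>" using \<delta> by (auto simp: field_simps)
    then show ?thesis by (simp add: \<phi>_def smooth_step_eq_1)
  qed
  \<comment> \<open>As \<open>y \<le> x - \<delta>\<close>, the descending step starts no earlier than the ascending one, so \<open>\<phi>\<close> is nonnegative.\<close>
  have "\<phi> z \<le> 1" for z using smooth_step_bounds unfolding \<phi>_def by (smt (verit))
  moreover have "0 \<le> \<phi> z" for z
    unfolding \<phi>_def using \<delta> by (simp add: smooth_step_mono divide_right_mono)
  ultimately have \<phi>: "\<bar>\<phi> z\<bar> \<le> indicator {y<..<x} z" for z
    using outside[of z] by (auto simp: indicator_def)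
  have test: "test_function l \<phi>"
    unfolding test_function_def
  proof (intro conjI allI)
    show "\<phi> differentiable at z" for z using deriv by (auto simp: real_differentiable_def)
    show "continuous_on UNIV (deriv \<phi>)"
      unfolding deriv_eq \<phi>'_def using \<delta> by (intro continuous_intros) auto
    show "\<exists>a b. 0 < a \<and> a \<le> b \<and> b < l \<and> (\<forall>z. z \<notin> {a..b} \<longrightarrow> \<phi> z = 0)"
      using yx outside by (intro exI[of _ y] exI[of _ x]) auto
  qed
  have hm [measurable]: "h \<in> borel_measurable (lebesgue_on {0..l})" using h by auto
  have [measurable]: "\<phi> \<in> borel_measurable (lebesgue_on {0..l})"
    using deriv by (intro continuous_imp_measurable_on_sets_lebesgue) (auto intro!: continuous_at_imp_continuous_on DERIV_isCont)
  have ih: "integrable (lebesgue_on {0..l}) (\<lambda>z. indicator {y<..<x} z *\<^sub>R \<bar>h z\<bar>)"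
    using h yx by (intro integrable_mult_indicator) (auto simp: sets_restrict_space_iff)
  have "\<bar>LINT z|lebesgue_on {0..l}. h z * \<phi> z\<bar> \<le> (LINT z:{y<..<x}|lebesgue_on {0..l}. \<bar>h z\<bar>)"
    unfolding set_lebesgue_integral_def
  proof (rule order_trans[OF integral_abs_bound integral_mono[OF _ ih]])
    show bound: "\<bar>h z * \<phi> z\<bar> \<le> indicator {y<..<x} z *\<^sub>R \<bar>h z\<bar>" for z
      using mult_left_mono[OF \<phi>[of z], of "\<bar>h z\<bar>"] by (simp add: abs_mult mult.commute)
    show "integrable (lebesgue_on {0..l}) (\<lambda>z. \<bar>h z * \<phi> z\<bar>)"
      by (rule Bochner_Integration.integrable_bound[OF ih]) (use bound in auto)
  qed
  moreover have "(LINT z|lebesgue_on {0..l}. w z * \<phi>' z)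
      = (LINT z|lebesgue_on {0..l}. w z * (hat ((z - y) / \<delta>) / \<delta>))
        - (LINT z|lebesgue_on {0..l}. w z * (hat ((z - (x - \<delta>)) / \<delta>) / \<delta>))"
    unfolding \<phi>'_def right_diff_distrib using \<delta>
    by (intro Bochner_Integration.integral_diff continuous_imp_integrable_real continuous_intros cont) auto
  moreover have "\<bar>(LINT z|lebesgue_on {0..l}. w z * (hat ((z - y) / \<delta>) / \<delta>)) - w y\<bar> \<le> \<epsilon> / 2"
    using \<delta> yx dy(2) by (intro hat_average[OF cont]) auto
  moreover have "\<bar>(LINT z|lebesgue_on {0..l}. w z * (hat ((z - (x - \<delta>)) / \<delta>) / \<delta>)) - w x\<bar> \<le> \<epsilon> / 2"
    using \<delta> yx dx(2) by (intro hat_average[OF cont]) auto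
  ultimately show "\<bar>w x - w y\<bar> \<le> (LINT z:{y<..<x}|lebesgue_on {0..l}. \<bar>h z\<bar>) + \<epsilon>"
    using weak[OF test] unfolding deriv_eq by linarith
qed

lemma set_integral_nonneg_mono:
  fixes D :: "'a \<Rightarrow> real"
  assumes "integrable M D" and "\<And>x. x \<in> space M \<Longrightarrow> 0 \<le> D x"
    and "S \<inter> space M \<subseteq> S'" "S \<inter> space M \<in> sets M" "S' \<inter> space M \<in> sets M"
  shows "(LINT x:S|M. D x) \<le> (LINT x:S'|M. D x)"
proof -
  have eq: "(LINT x:S|M. D x) = (LINT x:S \<inter> space M|M. D x)" for S
    unfolding set_lebesgue_integral_def by (rule Bochner_Integration.integral_cong) (auto simp: indicator_def)
  have "(LINT x:S \<inter> space M|M. D x) \<le> (LINT x:S' \<inter> space M|M. D x)"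
    unfolding set_lebesgue_integral_def using assms
    by (intro integral_mono integrable_mult_indicator) (auto simp: indicator_def)
  then show ?thesis using eq by simp
qed

lemma weak_derivative_increment:
  fixes w h :: "real \<Rightarrow> real"
  assumes cont: "continuous_on {0..l} w" and h: "integrable (lebesgue_on {0..l}) h"
    and weak: "\<And>\<phi>. test_function l \<phi> \<Longrightarrow>
      (LINT z|lebesgue_on {0..l}. w z * deriv \<phi> z) = - (LINT z|lebesgue_on {0..l}. h z * \<phi> z)"
    and yx: "0 \<le> y" "y \<le> x" "x \<le> l"
  shows "\<bar>w x - w y\<bar> \<le> (LINT z:{y<..<x}|lebesgue_on {0..l}. \<bar>h z\<bar>)"
proof (cases "y = x")
  case False
  with yx have lt: "y < x" by simp
  define r where "r n = (x - y) * (1 / real (n + 3))" for n :: nat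
  have r: "0 < r n" "r n \<le> (x - y) * (1 / 3)" for n
    unfolding r_def using lt by (simp, intro mult_left_mono) (auto simp: field_simps)
  have "(\<lambda>n. r n) \<longlonglongrightarrow> (x - y) * 0"
    unfolding r_def by (intro tendsto_intros LIMSEQ_ignore_initial_segment lim_1_over_n)
  then have r0: "r \<longlonglongrightarrow> 0" by simp
  have mem: "y + r n \<in> {0..l}" "x - r n \<in> {0..l}" "y + r n < x - r n" "0 < y + r n" "x - r n < l" for n
    using r[of n] yx lt by auto
  have "(\<lambda>n. w (x - r n)) \<longlonglongrightarrow> w x"
    using mem yx tendsto_diff[OF tendsto_const r0, of x]
    by (intro continuous_on_tendsto_compose[OF cont]) auto
  moreover have "(\<lambda>n. w (y + r n)) \<longlonglongrightarrow> w y"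
    using mem yx tendsto_add[OF tendsto_const r0, of y]
    by (intro continuous_on_tendsto_compose[OF cont]) auto
  ultimately have "(\<lambda>n. \<bar>w (x - r n) - w (y + r n)\<bar>) \<longlonglongrightarrow> \<bar>w x - w y\<bar>"
    by (intro tendsto_intros)
  then show ?thesis
  proof (rule LIMSEQ_le_const2, intro exI[of _ 0] allI impI)
    fix n
    have "\<bar>w (x - r n) - w (y + r n)\<bar> \<le> (LINT z:{y + r n<..<x - r n}|lebesgue_on {0..l}. \<bar>h z\<bar>)"
      using mem by (intro weak_derivative_increment_interior[OF cont h weak]) auto
    also have "\<dots> \<le> (LINT z:{y<..<x}|lebesgue_on {0..l}. \<bar>h z\<bar>)"
      using h r(1)[of n] by (intro set_integral_nonneg_mono) (auto simp: sets_restrict_space_iff)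
    finally show "\<bar>w (x - r n) - w (y + r n)\<bar> \<le> (LINT z:{y<..<x}|lebesgue_on {0..l}. \<bar>h z\<bar>)" .
  qed
qed (simp add: set_lebesgue_integral_def)

section \<open>The variation across a layer on a metric graph\<close>

lemma layer_sets:
  fixes w :: "real \<Rightarrow> real"
  assumes "continuous_on {0..l} w" and "0 \<le> y" "x \<le> l"
  shows "{z \<in> {y<..<x}. A < w z \<and> w z < B} \<in> sets (lebesgue_on {0..l})"
    and "{z \<in> {0..l}. A < w z \<and> w z < B} \<in> sets (lebesgue_on {0..l})"
proof -
  have [measurable]: "w \<in> borel_measurable (lebesgue_on {0..l})"
    using assms(1) by (intro continuous_imp_measurable_on_sets_lebesgue) auto
  have "{z \<in> space (lebesgue_on {0..l}). A < w z \<and> w z < B} \<in> sets (lebesgue_on {0..l})" by measurable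
  then show layer: "{z \<in> {0..l}. A < w z \<and> w z < B} \<in> sets (lebesgue_on {0..l})" by simp
  have "{y<..<x} \<in> sets (lebesgue_on {0..l})" using assms by (auto simp: sets_restrict_space_iff)
  from sets.Int[OF this layer] show "{z \<in> {y<..<x}. A < w z \<and> w z < B} \<in> sets (lebesgue_on {0..l})"
    by (rule rev_iffD1) (use assms in \<open>auto intro!: arg_cong[where f = "\<lambda>S. S \<in> sets (lebesgue_on {0..l})"]\<close>)
qed

text \<open>
  From now on \<open>D\<close> is an upper gradient of \<open>w\<close>, in the sense that the integral of \<open>D\<close> over \<open>(y, x)\<close> bounds
  the increment of \<open>w\<close> between \<open>y\<close> and \<open>x\<close>. If \<open>w\<close> passes from \<open>a\<close> up to \<open>b\<close>, then it does so on a subinterval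
  on which its values stay strictly between \<open>a\<close> and \<open>b\<close>.
\<close>

lemma layer_increment_up:
  fixes w D :: "real \<Rightarrow> real"
  assumes cont: "continuous_on {0..l} w" and D: "integrable (lebesgue_on {0..l}) D" "\<And>z. 0 \<le> D z"
    and inc: "\<And>y x. 0 \<le> y \<Longrightarrow> y \<le> x \<Longrightarrow> x \<le> l \<Longrightarrow> \<bar>w x - w y\<bar> \<le> (LINT z:{y<..<x}|lebesgue_on {0..l}. D z)"
    and yx: "0 \<le> y" "y \<le> x" "x \<le> l"
    and ab: "A \<le> a" "a < b" "b \<le> B" "w y \<le> a" "b \<le> w x"
  shows "b - a \<le> (LINT z:{z \<in> {y<..<x}. A < w z \<and> w z < B}|lebesgue_on {0..l}. D z)"
proof -
  have cyx: "continuous_on {y..x} w" using cont yx by (auto intro: continuous_on_subset)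
  have "compact {z \<in> {y..x}. b \<le> w z}"
    using continuous_closed_preimage[OF cyx closed_atLeastAtMost, of "{b..}"]
    by (auto simp: compact_eq_bounded_closed vimage_def Int_def intro: bounded_subset[OF bounded_closed_interval])
  \<comment> \<open>The first point where the level \<open>b\<close> is reached.\<close>
  then obtain x' where x': "x' \<in> {y..x}" "b \<le> w x'" and before: "\<And>z. z \<in> {y..x} \<Longrightarrow> b \<le> w z \<Longrightarrow> x' \<le> z"
    using compact_attains_inf[of "{z \<in> {y..x}. b \<le> w z}"] ab yx by auto
  have cyx': "continuous_on {y..x'} w" using cyx x' by (auto intro: continuous_on_subset)
  have "compact {z \<in> {y..x'}. w z \<le> a}"
    using continuous_closed_preimage[OF cyx' closed_atLeastAtMost, of "{..a}"]
    by (auto simp: compact_eq_bounded_closed vimage_def Int_def intro: bounded_subset[OF bounded_closed_interval])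
  \<comment> \<open>The last point before it where \<open>w\<close> is at most \<open>a\<close>.\<close>
  then obtain y' where y': "y' \<in> {y..x'}" "w y' \<le> a" and after: "\<And>z. z \<in> {y..x'} \<Longrightarrow> w z \<le> a \<Longrightarrow> z \<le> y'"
    using compact_attains_sup[of "{z \<in> {y..x'}. w z \<le> a}"] ab yx x' by auto
  have sub: "{y'<..<x'} \<subseteq> {z \<in> {y<..<x}. A < w z \<and> w z < B}"
  proof
    fix z assume z: "z \<in> {y'<..<x'}"
    then have "\<not> b \<le> w z" using before[of z] x' y' by auto
    moreover have "\<not> w z \<le> a" using after[of z] z x' y' by auto
    ultimately show "z \<in> {z \<in> {y<..<x}. A < w z \<and> w z < B}" using ab z x' y' by auto
  qed
  have "b - a \<le> \<bar>w x' - w y'\<bar>" using x' y' by linarith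
  also have "\<dots> \<le> (LINT z:{y'<..<x'}|lebesgue_on {0..l}. D z)" using x' y' yx by (intro inc) auto
  also have "\<dots> \<le> (LINT z:{z \<in> {y<..<x}. A < w z \<and> w z < B}|lebesgue_on {0..l}. D z)"
  proof (rule set_integral_nonneg_mono)
    show "{y'<..<x'} \<inter> space (lebesgue_on {0..l}) \<in> sets (lebesgue_on {0..l})"
      by (auto simp: sets_restrict_space_iff)
    show "{z \<in> {y<..<x}. A < w z \<and> w z < B} \<inter> space (lebesgue_on {0..l}) \<in> sets (lebesgue_on {0..l})"
      using layer_sets(1)[OF cont yx(1,3), of A B] by (rule sets.Int) simp
  qed (use D sub in auto)
  finally show ?thesis .
qed

text \<open>
  The clamped function \<open>max A (min B w)\<close> has the upper gradient that equals \<open>D\<close> on the layer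
  \<open>{A < w < B}\<close> and 0 elsewhere.
\<close>

lemma layer_increment:
  fixes w D :: "real \<Rightarrow> real"
  assumes cont: "continuous_on {0..l} w" and D: "integrable (lebesgue_on {0..l}) D" "\<And>z. 0 \<le> D z"
    and inc: "\<And>y x. 0 \<le> y \<Longrightarrow> y \<le> x \<Longrightarrow> x \<le> l \<Longrightarrow> \<bar>w x - w y\<bar> \<le> (LINT z:{y<..<x}|lebesgue_on {0..l}. D z)"
    and yx: "0 \<le> y" "y \<le> x" "x \<le> l" and AB: "A < B"
  shows "\<bar>max A (min B (w y)) - max A (min B (w x))\<bar>
    \<le> (LINT z:{z \<in> {y<..<x}. A < w z \<and> w z < B}|lebesgue_on {0..l}. D z)"
proof -
  define T where "T v = max A (min B v)" for v
  have nn: "0 \<le> (LINT z:{z \<in> {y<..<x}. A < w z \<and> w z < B}|lebesgue_on {0..l}. D z)"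
    unfolding set_lebesgue_integral_def using D by (intro Bochner_Integration.integral_nonneg) auto
  have up: "T (w x) - T (w y) \<le> (LINT z:{z \<in> {y<..<x}. A < w z \<and> w z < B}|lebesgue_on {0..l}. D z)"
  proof (cases "T (w y) < T (w x)")
    case True
    then show ?thesis
      using AB by (intro layer_increment_up[OF cont D inc yx]) (auto simp: T_def max_def min_def split: if_splits)
  qed (use nn in linarith)
  have down: "T (w y) - T (w x) \<le> (LINT z:{z \<in> {y<..<x}. A < w z \<and> w z < B}|lebesgue_on {0..l}. D z)"
  proof (cases "T (w x) < T (w y)")
    case True
    have "- T (w x) - (- T (w y)) \<le> (LINT z:{z \<in> {y<..<x}. - B < - w z \<and> - w z < - A}|lebesgue_on {0..l}. D z)"
    proof (rule layer_increment_up[OF _ D _ yx])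
      show "continuous_on {0..l} (\<lambda>z. - w z)" using cont by (intro continuous_intros)
      show "\<bar>- w x' - - w y'\<bar> \<le> (LINT z:{y'<..<x'}|lebesgue_on {0..l}. D z)"
        if "0 \<le> y'" "y' \<le> x'" "x' \<le> l" for y' x'
        using inc[OF that] by (simp add: abs_minus_commute)
    qed (use True AB in \<open>auto simp: T_def max_def min_def split: if_splits\<close>)
    then show ?thesis by (simp add: conj_commute)
  qed (use nn in linarith)
  show ?thesis using up down by (simp add: T_def abs_le_iff)
qed

lemma layer_variation:
  fixes w D :: "real \<Rightarrow> real" and P :: "nat \<Rightarrow> real"
  assumes cont: "continuous_on {0..l} w" and D: "integrable (lebesgue_on {0..l}) D" "\<And>z. 0 \<le> D z"
    and inc: "\<And>y x. 0 \<le> y \<Longrightarrow> y \<le> x \<Longrightarrow> x \<le> l \<Longrightarrow> \<bar>w x - w y\<bar> \<le> (LINT z:{y<..<x}|lebesgue_on {0..l}. D z)"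
    and P: "\<And>i. i < n \<Longrightarrow> P i \<le> P (Suc i)" "0 \<le> P 0" "P n \<le> l" and AB: "A < B"
  shows "(\<Sum>i<n. \<bar>max A (min B (w (P i))) - max A (min B (w (P (Suc i))))\<bar>)
    \<le> (LINT z:{z \<in> {0..l}. A < w z \<and> w z < B}|lebesgue_on {0..l}. D z)"
proof -
  have mono: "P i \<le> P j" if "i \<le> j" "j \<le> n" for i j
    using that by (induction j rule: dec_induct) (auto intro: order_trans[OF _ P(1)])
  have Pl: "0 \<le> P i" "P i \<le> l" if "i \<le> n" for i
    using mono[of 0 i] mono[of i n] P that by auto
  define S where "S i = {z \<in> {P i<..<P (Suc i)}. A < w z \<and> w z < B}" for i
  have sets: "S i \<in> sets (lebesgue_on {0..l})" if "i < n" for i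
    unfolding S_def using that Pl by (intro layer_sets cont) auto
  have "S i \<inter> S j = {}" if "i < j" "j < n" for i j
    using mono[of "Suc i" j] that by (auto simp: S_def)
  then have disj: "disjoint_family_on S {..<n}"
    unfolding disjoint_family_on_def by (metis Int_commute lessThan_iff linorder_neqE_nat)
  have "(\<Sum>i<n. \<bar>max A (min B (w (P i))) - max A (min B (w (P (Suc i))))\<bar>)
      \<le> (\<Sum>i<n. LINT z:S i|lebesgue_on {0..l}. D z)"
    unfolding S_def using Pl P(1) AB by (intro sum_mono layer_increment[OF cont D inc]) auto
  also have "\<dots> = (LINT z:(\<Union>i<n. S i)|lebesgue_on {0..l}. D z)"
    using disj sets D by (intro set_integral_finite_Union[symmetric])
      (auto simp: set_integrable_def intro!: integrable_mult_indicator[where f = D, simplified])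
  also have "\<dots> \<le> (LINT z:{z \<in> {0..l}. A < w z \<and> w z < B}|lebesgue_on {0..l}. D z)"
  proof (rule set_integral_nonneg_mono)
    show "(\<Union>i<n. S i) \<inter> space (lebesgue_on {0..l}) \<in> sets (lebesgue_on {0..l})" using sets by auto
    show "{z \<in> {0..l}. A < w z \<and> w z < B} \<inter> space (lebesgue_on {0..l}) \<in> sets (lebesgue_on {0..l})"
      using layer_sets(2)[OF cont, of 0 l A B] Pl[of 0] Pl[of n] by (intro sets.Int) auto
    show "(\<Union>i<n. S i) \<inter> space (lebesgue_on {0..l}) \<subseteq> {z \<in> {0..l}. A < w z \<and> w z < B}" by (auto simp: S_def)
  qed (use D in auto)
  finally show ?thesis .
qed

text \<open>
  The coarea-type bound. The points \<open>P e 0, ..., P e 3\<close> divide each edge into three segments such that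
  the inner two points include a minimum and a maximum of \<open>w\<close> on the edge; \<open>C t\<close> is the set of segments
  whose end values are separated by the level \<open>t\<close>. If all vertices lie on the same side of \<open>t\<close>, then the
  segments of a single edge provide only two crossings, hence the restriction to \<open>k \<le> 2\<close>.
\<close>

lemma graph_layer_bound:
  fixes G :: "('v, 'e) pre_digraph" and w D :: "'e \<Rightarrow> real \<Rightarrow> real"
  assumes graph: "compact_metric_graph G len" and conn: "edge_connectivity_ge G k" and k: "k \<le> 2"
    and cont: "\<And>e. e \<in> arcs G \<Longrightarrow> continuous_on {0..len e} (w e)"
    and ends: "\<And>e. e \<in> arcs G \<Longrightarrow> w e 0 = U (tail G e)" "\<And>e. e \<in> arcs G \<Longrightarrow> w e (len e) = U (head G e)"
    and D: "\<And>e. e \<in> arcs G \<Longrightarrow> integrable (lebesgue_on {0..len e}) (D e)" "\<And>e z. 0 \<le> D e z"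
    and inc: "\<And>e y x. e \<in> arcs G \<Longrightarrow> 0 \<le> y \<Longrightarrow> y \<le> x \<Longrightarrow> x \<le> len e \<Longrightarrow>
      \<bar>w e x - w e y\<bar> \<le> (LINT z:{y<..<x}|lebesgue_on {0..len e}. D e z)"
    and low: "e0 \<in> arcs G" "x0 \<in> {0..len e0}" "w e0 x0 \<le> A"
    and high: "e1 \<in> arcs G" "x1 \<in> {0..len e1}" "B \<le> w e1 x1" and AB: "A < B"
  shows "real k * (B - A)
    \<le> (\<Sum>e\<in>arcs G. LINT z:{z \<in> {0..len e}. A < w e z \<and> w e z < B}|lebesgue_on {0..len e}. D e z)"
proof -
  interpret compact_metric_graph G len by fact
  have "\<exists>p q. 0 \<le> p \<and> p \<le> q \<and> q \<le> len e \<and> (\<forall>z\<in>{0..len e}. min (w e p) (w e q) \<le> w e z \<and> w e z \<le> max (w e p) (w e q))"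
    if e: "e \<in> arcs G" for e
  proof -
    have ne: "{0..len e} \<noteq> {}" using len_pos[OF e] by simp
    obtain m where m: "m \<in> {0..len e}" "\<And>z. z \<in> {0..len e} \<Longrightarrow> w e m \<le> w e z"
      using continuous_attains_inf[OF compact_Icc ne cont[OF e]] by blast
    obtain m' where m': "m' \<in> {0..len e}" "\<And>z. z \<in> {0..len e} \<Longrightarrow> w e z \<le> w e m'"
      using continuous_attains_sup[OF compact_Icc ne cont[OF e]] by blast
    have "min (w e (min m m')) (w e (max m m')) \<le> w e m" "w e m' \<le> max (w e (min m m')) (w e (max m m'))"
      by (auto simp: min_def max_def)
    then have "\<forall>z\<in>{0..len e}. min (w e (min m m')) (w e (max m m')) \<le> w e z \<and>
        w e z \<le> max (w e (min m m')) (w e (max m m'))"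
      using m(2) m'(2) by (blast intro: order_trans)
    then show ?thesis
      by (intro exI[of _ "min m m'"] exI[of _ "max m m'"]) (use m(1) m'(1) in auto)
  qed
  then obtain p q where pq: "\<And>e. e \<in> arcs G \<Longrightarrow> 0 \<le> p e \<and> p e \<le> q e \<and> q e \<le> len e \<and>
      (\<forall>z\<in>{0..len e}. min (w e (p e)) (w e (q e)) \<le> w e z \<and> w e z \<le> max (w e (p e)) (w e (q e)))"
    by metis
  define P where "P e i = (if i = 0 then 0 else if i = 1 then p e else if i = 2 then q e else len e)" for e and i :: nat
  define C where "C t = {j \<in> arcs G \<times> {..<3}. (w (fst j) (P (fst j) (snd j)) \<le> t) \<noteq>
      (w (fst j) (P (fst j) (Suc (snd j))) \<le> t)}" for t
  have finC: "finite (C t)" for t by (rule finite_subset[of _ "arcs G \<times> {..<3}"]) (auto simp: C_def)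
  have mem0: "(e, 0) \<in> C t \<longleftrightarrow> (w e 0 \<le> t) \<noteq> (w e (p e) \<le> t)"
    and mem1: "(e, 1) \<in> C t \<longleftrightarrow> (w e (p e) \<le> t) \<noteq> (w e (q e) \<le> t)"
    and mem2: "(e, 2) \<in> C t \<longleftrightarrow> (w e (q e) \<le> t) \<noteq> (w e (len e) \<le> t)" if "e \<in> arcs G" for e t
    using that by (auto simp: C_def P_def)
  have two: "2 \<le> card (C t)"
    if e: "e \<in> arcs G" "(w e 0 \<le> t) = \<sigma>" "(w e (len e) \<le> t) = \<sigma>" "(w e (p e) \<le> t) \<noteq> \<sigma> \<or> (w e (q e) \<le> t) \<noteq> \<sigma>"
    for e t \<sigma>
  proof -
    have "\<exists>i j. i \<noteq> j \<and> {(e, i), (e, j)} \<subseteq> C t"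
    proof (cases "(w e (p e) \<le> t) = (w e (q e) \<le> t)")
      case True
      then show ?thesis using e mem0 mem2 by (intro exI[of _ 0] exI[of _ 2]) auto
    next
      case False
      show ?thesis
      proof (cases "(w e (p e) \<le> t) = \<sigma>")
        case True
        then show ?thesis using False e mem1[of e t] mem2[of e t] by (intro exI[of _ 1] exI[of _ 2]) auto
      next
        case False
        then show ?thesis using \<open>(w e (p e) \<le> t) \<noteq> (w e (q e) \<le> t)\<close> e mem0[of e t] mem1[of e t]
          by (intro exI[of _ 0] exI[of _ 1]) auto
      qed
    qed
    then obtain i j where ij: "i \<noteq> j" "{(e, i), (e, j)} \<subseteq> C t" by blast
    have "card {(e, i), (e, j)} \<le> card (C t)" by (rule card_mono[OF finC ij(2)])
    then show ?thesis using ij(1) by simp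
  qed
  have cross: "k \<le> card (C t)" if t: "A \<le> t" "t < B" for t
  proof -
    define S where "S = {v. U v \<le> t}"
    consider "S \<inter> verts G \<noteq> {} \<and> verts G - S \<noteq> {}" | "S \<inter> verts G = {}" | "verts G \<subseteq> S" by blast
    then show ?thesis
    proof cases
      case 1
      have "edge_cut G S \<subseteq> fst ` C t"
      proof
        fix e assume "e \<in> edge_cut G S"
        then have e: "e \<in> arcs G" "(w e 0 \<le> t) \<noteq> (w e (len e) \<le> t)"
          by (auto simp: edge_cut_def S_def ends)
        then have "(e, 0) \<in> C t \<or> (e, 1) \<in> C t \<or> (e, 2) \<in> C t" using mem0 mem1 mem2 by blast
        then show "e \<in> fst ` C t" by force
      qed
      then have "card (edge_cut G S) \<le> card (C t)"
        using finC by (meson card_image_le card_mono finite_imageI le_trans)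
      moreover have "k \<le> card (edge_cut G S)" using conn 1 by (auto simp: edge_connectivity_ge_def)
      ultimately show ?thesis by linarith
    next
      case 2
      then have "\<not> w e0 0 \<le> t" "\<not> w e0 (len e0) \<le> t" using low(1) by (auto simp: S_def ends)
      moreover have "w e0 (p e0) \<le> t \<or> w e0 (q e0) \<le> t" using pq[OF low(1)] low t by fastforce
      ultimately have "2 \<le> card (C t)" using two[OF low(1), of t False] by auto
      then show ?thesis using k by linarith
    next
      case 3
      then have "w e1 0 \<le> t" "w e1 (len e1) \<le> t"
        using high(1) subsetD[OF 3 tail_in_verts] subsetD[OF 3 head_in_verts] by (auto simp: S_def ends)
      moreover have "\<not> w e1 (p e1) \<le> t \<or> \<not> w e1 (q e1) \<le> t" using pq[OF high(1)] high t by fastforce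
      ultimately have "2 \<le> card (C t)" using two[OF high(1), of t True] by auto
      then show ?thesis using k by linarith
    qed
  qed
  define T where "T v = max A (min B v)" for v
  have "real k * (B - A) \<le> (\<Sum>(e, i)\<in>arcs G \<times> {..<3}. \<bar>T (w e (P e i)) - T (w e (P e (Suc i)))\<bar>)"
    unfolding case_prod_beta
  proof (rule sum_abs_diff_ge_crossings)
    fix t assume t: "A \<le> t" "t < B"
    then have "T v \<le> t \<longleftrightarrow> v \<le> t" for v by (auto simp: T_def)
    then have "{j \<in> arcs G \<times> {..<3}. (T (w (fst j) (P (fst j) (snd j))) \<le> t) \<noteq>
        (T (w (fst j) (P (fst j) (Suc (snd j)))) \<le> t)} = C t"
      by (simp add: C_def)
    then show "k \<le> card {j \<in> arcs G \<times> {..<3}. (T (w (fst j) (P (fst j) (snd j))) \<le> t) \<noteq>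
        (T (w (fst j) (P (fst j) (Suc (snd j)))) \<le> t)}"
      using cross[OF t] by simp
  qed (use AB in auto)
  also have "\<dots> = (\<Sum>e\<in>arcs G. \<Sum>i<3. \<bar>T (w e (P e i)) - T (w e (P e (Suc i)))\<bar>)"
    by (rule sum.cartesian_product[symmetric])
  also have "\<dots> \<le> (\<Sum>e\<in>arcs G. LINT z:{z \<in> {0..len e}. A < w e z \<and> w e z < B}|lebesgue_on {0..len e}. D e z)"
    unfolding T_def
  proof (rule sum_mono)
    fix e assume e: "e \<in> arcs G"
    show "(\<Sum>i<3. \<bar>max A (min B (w e (P e i))) - max A (min B (w e (P e (Suc i))))\<bar>)
        \<le> (LINT z:{z \<in> {0..len e}. A < w e z \<and> w e z < B}|lebesgue_on {0..len e}. D e z)"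
      by (rule layer_variation[OF cont[OF e] D(1)[OF e] D(2) inc[OF e]])
        (use pq[OF e] AB in \<open>auto simp: P_def\<close>)
  qed
  finally show ?thesis .
qed

section \<open>The Poincare inequality on a metric graph\<close>

text \<open>
  The Lebesgue measure on the disjoint union of the edges. A point is a pair of an edge and a
  parameter; the gluing at the vertices only concerns null sets.
\<close>

definition graph_measure :: "('v, 'e) pre_digraph \<Rightarrow> ('e \<Rightarrow> real) \<Rightarrow> ('e \<times> real) measure" where
  "graph_measure G len =
     restrict_space (count_space (arcs G) \<Otimes>\<^sub>M lebesgue) (SIGMA e:arcs G. {0..len e})"

lemma sigma_finite_lebesgue: "sigma_finite_measure (lebesgue :: real measure)"
proof
  obtain A :: "real set set" where "countable A" "A \<subseteq> sets lborel" "\<Union> A = space lborel" "\<forall>a\<in>A. emeasure lborel a \<noteq> \<infinity>"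
    using lborel.sigma_finite_countable by blast
  then show "\<exists>A. countable A \<and> A \<subseteq> sets (lebesgue :: real measure) \<and> \<Union> A = space (lebesgue :: real measure) \<and>
      (\<forall>a\<in>A. emeasure (lebesgue :: real measure) a \<noteq> \<infinity>)"
    by (intro exI[of _ A]) (auto simp: subset_eq)
qed

context compact_metric_graph
begin

lemma space_graph_measure: "space (graph_measure G len) = (SIGMA e:arcs G. {0..len e})"
  by (auto simp: graph_measure_def space_restrict_space space_pair_measure)

lemma graph_points_measurable:
  "(SIGMA e:arcs G. {0..len e}) \<inter> space (count_space (arcs G) \<Otimes>\<^sub>M lebesgue)
    \<in> sets (count_space (arcs G) \<Otimes>\<^sub>M lebesgue)"
proof -
  have "(SIGMA e:arcs G. {0..len e}) = (\<Union>e\<in>arcs G. {e} \<times> {0..len e})" by auto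
  also have "\<dots> \<in> sets (count_space (arcs G) \<Otimes>\<^sub>M lebesgue)" by (intro sets.finite_UN) auto
  finally show ?thesis by auto
qed

lemma graph_measurable:
  fixes F :: "'e \<Rightarrow> real \<Rightarrow> real"
  assumes "\<And>e. e \<in> arcs G \<Longrightarrow> F e \<in> borel_measurable (lebesgue_on {0..len e})"
  shows "(\<lambda>(e, x). F e x) \<in> borel_measurable (graph_measure G len)"
  unfolding graph_measure_def borel_measurable_restrict_space_iff[OF graph_points_measurable]
proof (rule measurable_pair_measure_countable1)
  fix e assume e: "e \<in> arcs G"
  have "(\<lambda>x. indicator {0..len e} x *\<^sub>R F e x) \<in> borel_measurable lebesgue"
    using assms[OF e] by (subst (asm) borel_measurable_restrict_space_iff) auto
  also have "(\<lambda>x. indicator {0..len e} x *\<^sub>R F e x) =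
      (\<lambda>x. indicator (SIGMA e:arcs G. {0..len e}) (e, x) *\<^sub>R (case (e, x) of (e, x) \<Rightarrow> F e x))"
    using e by (auto simp: indicator_def fun_eq_iff)
  finally show "\<dots> \<in> borel_measurable lebesgue" .
qed (simp add: countable_finite)

text \<open>
  Integration over the graph is integration edge by edge.
\<close>

lemma graph_measure_integral:
  fixes F :: "'e \<Rightarrow> real \<Rightarrow> real"
  assumes F: "\<And>e. e \<in> arcs G \<Longrightarrow> integrable (lebesgue_on {0..len e}) (F e)"
  shows "integrable (graph_measure G len) (\<lambda>(e, x). F e x)"
    and "(LINT p|graph_measure G len. (case p of (e, x) \<Rightarrow> F e x)) = (\<Sum>e\<in>arcs G. LINT x|lebesgue_on {0..len e}. F e x)"
proof -
  interpret pair_sigma_finite "count_space (arcs G)" "lebesgue :: real measure"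
    by (intro pair_sigma_finite.intro sigma_finite_measure_count_space_finite sigma_finite_lebesgue) simp
  define H where "H p = indicator (SIGMA e:arcs G. {0..len e}) p *\<^sub>R (case p of (e, x) \<Rightarrow> F e x)" for p
  have Heq: "H (e, x) = indicator {0..len e} x *\<^sub>R F e x" if "e \<in> arcs G" for e x
    using that by (auto simp: H_def indicator_def)
  have iH: "integrable lebesgue (\<lambda>x. H (e, x))" if "e \<in> arcs G" for e
    using F[OF that] that by (subst (asm) integrable_restrict_space) (auto simp: Heq)
  have "H \<in> borel_measurable (count_space (arcs G) \<Otimes>\<^sub>M lebesgue)"
    using graph_measurable[of F] F
    unfolding H_def graph_measure_def borel_measurable_restrict_space_iff[OF graph_points_measurable] by blast
  then have int: "integrable (count_space (arcs G) \<Otimes>\<^sub>M lebesgue) H"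
    using iH by (intro Fubini_integrable) (auto simp: AE_count_space integrable_count_space)
  then show "integrable (graph_measure G len) (\<lambda>(e, x). F e x)"
    unfolding graph_measure_def integrable_restrict_space[OF graph_points_measurable] H_def .
  have "(LINT p|graph_measure G len. (case p of (e, x) \<Rightarrow> F e x)) = integral\<^sup>L (count_space (arcs G) \<Otimes>\<^sub>M lebesgue) H"
    unfolding graph_measure_def integral_restrict_space[OF graph_points_measurable] H_def ..
  also have "\<dots> = (\<Sum>e\<in>arcs G. LINT x|lebesgue. H (e, x))"
    using integral_fst'[OF int] by (simp add: lebesgue_integral_count_space_finite)
  also have "\<dots> = (\<Sum>e\<in>arcs G. LINT x|lebesgue_on {0..len e}. F e x)"
    by (intro sum.cong) (auto simp: Heq integral_restrict_space)
  finally show "(LINT p|graph_measure G len. (case p of (e, x) \<Rightarrow> F e x)) = (\<Sum>e\<in>arcs G. LINT x|lebesgue_on {0..len e}. F e x)" .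
qed

lemma total_length_pos: "0 < total_length G len"
  unfolding total_length_def using arcs_nonempty len_pos by (intro sum_pos) auto

lemma graph_measure_space:
  "finite_measure (graph_measure G len)" "measure (graph_measure G len) (space (graph_measure G len)) = total_length G len"
proof -
  have one: "integrable (lebesgue_on {0..len e}) (\<lambda>x. 1 :: real)" for e
    by (intro continuous_imp_integrable_real continuous_intros)
  have const: "(\<lambda>(e :: 'e, x :: real). 1 :: real) = (\<lambda>p. 1)" by auto
  have int: "integrable (graph_measure G len) (\<lambda>p. 1 :: real)"
    using graph_measure_integral(1)[of "\<lambda>_ _. 1", OF one] unfolding const .
  then show fin: "finite_measure (graph_measure G len)"
    by (intro finite_measureI) (auto simp: integrable_iff_bounded)
  have "measure (graph_measure G len) (space (graph_measure G len)) = (LINT p|graph_measure G len. 1)"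
    by simp
  also have "\<dots> = (\<Sum>e\<in>arcs G. LINT x|lebesgue_on {0..len e}. 1)"
    using graph_measure_integral(2)[of "\<lambda>_ _. 1", OF one] unfolding const .
  also have "\<dots> = total_length G len"
    unfolding total_length_def
  proof (rule sum.cong)
    fix e assume "e \<in> arcs G"
    then have "0 < len e" by (rule len_pos)
    then show "(LINT x|lebesgue_on {0..len e}. 1) = len e"
      by (simp add: measure_restrict_space)
  qed simp
  finally show "measure (graph_measure G len) (space (graph_measure G len)) = total_length G len" .
qed

lemma graph_attains_inf:
  fixes w :: "'e \<Rightarrow> real \<Rightarrow> real"
  assumes "\<And>e. e \<in> arcs G \<Longrightarrow> continuous_on {0..len e} (w e)"
  obtains e0 x0 where "e0 \<in> arcs G" "x0 \<in> {0..len e0}"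
    and "\<And>e x. e \<in> arcs G \<Longrightarrow> x \<in> {0..len e} \<Longrightarrow> w e0 x0 \<le> w e x"
proof -
  have "\<exists>m. m \<in> {0..len e} \<and> (\<forall>x\<in>{0..len e}. w e m \<le> w e x)" if "e \<in> arcs G" for e
    using continuous_attains_inf[of "{0..len e}" "w e"] assms[OF that] len_pos[OF that] by force
  then obtain m where m: "\<And>e. e \<in> arcs G \<Longrightarrow> m e \<in> {0..len e} \<and> (\<forall>x\<in>{0..len e}. w e (m e) \<le> w e x)"
    by metis
  obtain e0 where e0: "e0 \<in> arcs G" "\<And>e. e \<in> arcs G \<Longrightarrow> w e0 (m e0) \<le> w e (m e)"
    using finite_arcs arcs_nonempty arg_min_if_finite[of "arcs G" "\<lambda>e. w e (m e)"] by (meson not_le)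
  show ?thesis
    by (rule that[OF e0(1), of "m e0"]) (use m e0 in \<open>blast intro: order_trans\<close>)+
qed

lemma graph_poincare_real:
  fixes w D :: "'e \<Rightarrow> real \<Rightarrow> real"
  assumes conn: "edge_connectivity_ge G k" and k: "1 \<le> k" "k \<le> 2"
    and cont: "\<And>e. e \<in> arcs G \<Longrightarrow> continuous_on {0..len e} (w e)"
    and ends: "\<And>e. e \<in> arcs G \<Longrightarrow> w e 0 = U (tail G e)" "\<And>e. e \<in> arcs G \<Longrightarrow> w e (len e) = U (head G e)"
    and D: "\<And>e. e \<in> arcs G \<Longrightarrow> integrable (lebesgue_on {0..len e}) (D e)" "\<And>e x. 0 \<le> D e x"
      "\<And>e. e \<in> arcs G \<Longrightarrow> integrable (lebesgue_on {0..len e}) (\<lambda>x. (D e x)\<^sup>2)"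
    and inc: "\<And>e y x. e \<in> arcs G \<Longrightarrow> 0 \<le> y \<Longrightarrow> y \<le> x \<Longrightarrow> x \<le> len e \<Longrightarrow>
      \<bar>w e x - w e y\<bar> \<le> (LINT z:{y<..<x}|lebesgue_on {0..len e}. D e z)"
    and mean: "(\<Sum>e\<in>arcs G. LINT x|lebesgue_on {0..len e}. w e x) = 0"
  shows "(real k * pi / total_length G len)\<^sup>2 * (\<Sum>e\<in>arcs G. LINT x|lebesgue_on {0..len e}. (w e x)\<^sup>2)
    \<le> (\<Sum>e\<in>arcs G. LINT x|lebesgue_on {0..len e}. (D e x)\<^sup>2)"
proof -
  let ?M = "graph_measure G len"
  interpret M: finite_measure ?M by (rule graph_measure_space)
  obtain e0 x0 where low: "e0 \<in> arcs G" "x0 \<in> {0..len e0}"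
      "\<And>e x. e \<in> arcs G \<Longrightarrow> x \<in> {0..len e} \<Longrightarrow> w e0 x0 \<le> w e x"
    using graph_attains_inf[OF cont] by blast
  obtain e1 x1 where high: "e1 \<in> arcs G" "x1 \<in> {0..len e1}"
      "\<And>e x. e \<in> arcs G \<Longrightarrow> x \<in> {0..len e} \<Longrightarrow> - w e1 x1 \<le> - w e x"
    using graph_attains_inf[of "\<lambda>e x. - w e x"] cont by (metis continuous_on_minus)
  have iw: "integrable (lebesgue_on {0..len e}) (w e)" "integrable (lebesgue_on {0..len e}) (\<lambda>x. (w e x)\<^sup>2)"
    if "e \<in> arcs G" for e
    using cont[OF that] by (auto intro!: continuous_imp_integrable_real continuous_intros)
  define f where "f = (\<lambda>(e, x). w e x)"
  define d where "d = (\<lambda>(e, x). D e x)"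
  have sq: "(\<lambda>p. (f p)\<^sup>2) = (\<lambda>(e, x). (w e x)\<^sup>2)" "(\<lambda>p. (d p)\<^sup>2) = (\<lambda>(e, x). (D e x)\<^sup>2)"
    by (auto simp: f_def d_def)
  have "(real k * pi / measure ?M (space ?M))\<^sup>2 * (LINT p|?M. (f p)\<^sup>2) \<le> (LINT p|?M. (d p)\<^sup>2)"
  proof (rule M.mean_zero_poincare[where p = "(e0, x0)" and q = "(e1, x1)"])
    show "f \<in> borel_measurable ?M" unfolding f_def using iw by (intro graph_measurable) auto
    show "d \<in> borel_measurable ?M" unfolding d_def using D by (intro graph_measurable) auto
    show "integrable ?M (\<lambda>p. (d p)\<^sup>2)" unfolding sq using D by (intro graph_measure_integral) auto
    show "(LINT p|?M. f p) = 0" unfolding f_def using mean iw by (subst graph_measure_integral) auto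
    show "0 < measure ?M (space ?M)" unfolding graph_measure_space by (rule total_length_pos)
    show "f (e0, x0) \<le> f p \<and> f p \<le> f (e1, x1)" if "p \<in> space ?M" for p
      using that low high by (force simp: f_def space_graph_measure)
    fix A B :: real assume AB: "f (e0, x0) \<le> A" "A < B" "B \<le> f (e1, x1)"
    define I where "I e x = indicator {z \<in> {0..len e}. A < w e z \<and> w e z < B} x *\<^sub>R D e x" for e x
    have "real k * (B - A) \<le> (\<Sum>e\<in>arcs G. LINT z:{z \<in> {0..len e}. A < w e z \<and> w e z < B}|lebesgue_on {0..len e}. D e z)"
      by (rule graph_layer_bound[OF compact_metric_graph_axioms conn k(2) cont ends D(1,2) inc low(1,2) _ high(1,2)])
        (use AB in \<open>auto simp: f_def\<close>)
    also have "\<dots> = (LINT p|?M. (case p of (e, x) \<Rightarrow> I e x))"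
      unfolding set_lebesgue_integral_def
    proof (subst graph_measure_integral(2))
      fix e assume e: "e \<in> arcs G"
      show "integrable (lebesgue_on {0..len e}) (I e)"
        unfolding I_def[abs_def] using layer_sets(2)[OF cont[OF e], of 0 "len e"] D(1)[OF e]
        by (intro integrable_mult_indicator) auto
    qed (simp add: I_def[abs_def])
    also have "\<dots> = (LINT p:{p \<in> space ?M. A < f p \<and> f p < B}|?M. d p)"
      unfolding set_lebesgue_integral_def
      by (intro Bochner_Integration.integral_cong) (auto simp: I_def f_def d_def space_graph_measure indicator_def)
    finally show "real k * (B - A) \<le> (LINT p:{p \<in> space ?M. A < f p \<and> f p < B}|?M. d p)" .
  qed (use k D low high in \<open>auto simp: d_def space_graph_measure\<close>)
  moreover have "(LINT p|?M. (f p)\<^sup>2) = (\<Sum>e\<in>arcs G. LINT x|lebesgue_on {0..len e}. (w e x)\<^sup>2)"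
    unfolding sq using iw by (intro graph_measure_integral(2))
  moreover have "(LINT p|?M. (d p)\<^sup>2) = (\<Sum>e\<in>arcs G. LINT x|lebesgue_on {0..len e}. (D e x)\<^sup>2)"
    unfolding sq using D by (intro graph_measure_integral(2))
  ultimately show ?thesis by (simp add: graph_measure_space)
qed

end

section \<open>The lower bound for the threshold mass\<close>

lemma L2_interval_integrable:
  assumes "L2_interval l g"
  shows "integrable (lebesgue_on {0..l}) g"
proof (rule Bochner_Integration.integrable_bound)
  show "integrable (lebesgue_on {0..l}) (\<lambda>x. 1 + (cmod (g x))\<^sup>2)"
    using assms by (auto simp: L2_interval_def intro!: Bochner_Integration.integrable_add
        continuous_imp_integrable_real continuous_intros)
  show "g \<in> borel_measurable (lebesgue_on {0..l})" using assms by (simp add: L2_interval_def)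
  have "cmod z \<le> 1 + (cmod z)\<^sup>2" for z
    using sum_squares_bound[of "cmod z" 1] norm_ge_zero[of z] by (simp only: mult_1_right one_power2)
  then show "AE x in lebesgue_on {0..l}. cmod (g x) \<le> norm (1 + (cmod (g x))\<^sup>2)" by simp
qed

lemma L2_interval_component:
  assumes "L2_interval l g"
  shows "integrable (lebesgue_on {0..l}) (\<lambda>x. (Re (g x))\<^sup>2)" "integrable (lebesgue_on {0..l}) (\<lambda>x. (Im (g x))\<^sup>2)"
proof -
  have [measurable]: "g \<in> borel_measurable (lebesgue_on {0..l})"
    and g: "integrable (lebesgue_on {0..l}) (\<lambda>x. (cmod (g x))\<^sup>2)" using assms by (auto simp: L2_interval_def)
  show "integrable (lebesgue_on {0..l}) (\<lambda>x. (Re (g x))\<^sup>2)" "integrable (lebesgue_on {0..l}) (\<lambda>x. (Im (g x))\<^sup>2)"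
    by (rule Bochner_Integration.integrable_bound[OF g]; simp add: cmod_power2)+
qed

lemma test_function_C1:
  assumes "test_function l \<phi>"
  shows "(\<phi> has_real_derivative deriv \<phi> x) (at x)"
    and "continuous_on S \<phi>" and "continuous_on S (deriv \<phi>)"
proof -
  show d: "(\<phi> has_real_derivative deriv \<phi> x) (at x)" for x
    using assms by (simp add: test_function_def DERIV_deriv_iff_real_differentiable)
  show "continuous_on S \<phi>" using d by (auto intro!: continuous_at_imp_continuous_on DERIV_isCont)
  have "continuous_on UNIV (deriv \<phi>)" using assms by (simp add: test_function_def)
  then show "continuous_on S (deriv \<phi>)" by (rule continuous_on_subset) simp
qed

lemma weak_deriv_component:
  assumes u: "continuous_on {0..l} u" and g: "L2_interval l g" and weak: "weak_deriv l u g" and \<phi>: "test_function l \<phi>"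
  shows "(LINT x|lebesgue_on {0..l}. Re (u x) * deriv \<phi> x) = - (LINT x|lebesgue_on {0..l}. Re (g x) * \<phi> x)"
    and "(LINT x|lebesgue_on {0..l}. Im (u x) * deriv \<phi> x) = - (LINT x|lebesgue_on {0..l}. Im (g x) * \<phi> x)"
proof -
  note c = test_function_C1(2,3)[OF \<phi>, of "{0..l}"]
  have iu: "integrable (lebesgue_on {0..l}) (\<lambda>x. u x * of_real (deriv \<phi> x))"
    by (intro continuous_imp_integrable_real continuous_intros u c)
  obtain C where "\<forall>x\<in>{0..l}. \<bar>\<phi> x\<bar> \<le> C"
    using compact_imp_bounded[OF compact_continuous_image[OF c(1) compact_Icc]] by (auto simp: bounded_iff)
  then have C: "\<bar>\<phi> x\<bar> \<le> C" if "x \<in> {0..l}" for x using that by blast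
  have [measurable]: "g \<in> borel_measurable (lebesgue_on {0..l})" using g by (simp add: L2_interval_def)
  have [measurable]: "\<phi> \<in> borel_measurable (lebesgue_on {0..l})"
    using c by (intro continuous_imp_measurable_on_sets_lebesgue) auto
  have ig: "integrable (lebesgue_on {0..l}) (\<lambda>x. g x * of_real (\<phi> x))"
  proof (rule Bochner_Integration.integrable_bound)
    show "integrable (lebesgue_on {0..l}) (\<lambda>x. C * cmod (g x))"
      using L2_interval_integrable[OF g] by (intro integrable_mult_right integrable_norm)
    show "AE x in lebesgue_on {0..l}. cmod (g x * of_real (\<phi> x)) \<le> norm (C * cmod (g x))"
    proof (rule AE_I2)
      fix x assume "x \<in> space (lebesgue_on {0..l})"
      then have "\<bar>\<phi> x\<bar> \<le> \<bar>C\<bar>" using C[of x] by simp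
      then have "cmod (g x) * \<bar>\<phi> x\<bar> \<le> cmod (g x) * \<bar>C\<bar>" by (intro mult_left_mono) auto
      then show "cmod (g x * of_real (\<phi> x)) \<le> norm (C * cmod (g x))"
        by (simp add: norm_mult abs_mult mult.commute)
    qed
  qed simp
  have eq: "(LINT x|lebesgue_on {0..l}. u x * of_real (deriv \<phi> x)) = - (LINT x|lebesgue_on {0..l}. g x * of_real (\<phi> x))"
    using weak \<phi> by (simp add: weak_deriv_def)
  show "(LINT x|lebesgue_on {0..l}. Re (u x) * deriv \<phi> x) = - (LINT x|lebesgue_on {0..l}. Re (g x) * \<phi> x)"
    using arg_cong[OF eq, of Re] integral_Re[OF iu] integral_Re[OF ig] by simp
  show "(LINT x|lebesgue_on {0..l}. Im (u x) * deriv \<phi> x) = - (LINT x|lebesgue_on {0..l}. Im (g x) * \<phi> x)"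
    using arg_cong[OF eq, of Im] integral_Im[OF iu] integral_Im[OF ig] by simp
qed

lemma H1_deriv_weak_deriv:
  assumes "u \<in> H1_interval l"
  shows "L2_interval l (H1_deriv l u)" "weak_deriv l u (H1_deriv l u)"
proof -
  have "\<exists>g. L2_interval l g \<and> weak_deriv l u g" using assms by (simp add: H1_interval_def)
  from someI_ex[OF this] show "L2_interval l (H1_deriv l u)" "weak_deriv l u (H1_deriv l u)"
    unfolding H1_deriv_def by (rule conjunct1, rule conjunct2)
qed

text \<open>
  For a continuously differentiable function the weak derivative is the classical one, by integration
  by parts.
\<close>

lemma smooth_in_H1_interval:
  assumes u: "\<And>x. (u has_vector_derivative u' x) (at x)" and u': "continuous_on UNIV u'"
  shows "u \<in> H1_interval l"
proof -
  have cu: "continuous_on S u" for S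
    using u by (auto intro!: continuous_at_imp_continuous_on has_vector_derivative_continuous)
  have cu': "continuous_on S u'" for S using u' by (rule continuous_on_subset) simp
  have L2: "L2_interval l h" if "continuous_on {0..l} h" for h
    unfolding L2_interval_def using that
    by (auto intro!: continuous_imp_measurable_on_sets_lebesgue continuous_imp_integrable_real continuous_intros)
  have "weak_deriv l u u'"
    unfolding weak_deriv_def
  proof (intro allI impI)
    fix \<phi> assume \<phi>: "test_function l \<phi>"
    then obtain a b where ab: "0 < a" "a \<le> b" "b < l" "\<And>x. x \<notin> {a..b} \<Longrightarrow> \<phi> x = 0"
      unfolding test_function_def by blast
    note d\<phi> = test_function_C1(1)[OF \<phi>]
    note c = test_function_C1(2,3)[OF \<phi>]
    have "((\<lambda>x. u x * of_real (deriv \<phi> x) + u' x * of_real (\<phi> x)) has_integral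
        u l * of_real (\<phi> l) - u 0 * of_real (\<phi> 0)) {0..l}"
    proof (rule fundamental_theorem_of_calculus)
      fix x
      show "((\<lambda>x. u x * of_real (\<phi> x)) has_vector_derivative u x * of_real (deriv \<phi> x) + u' x * of_real (\<phi> x)) (at x within {0..l})"
        using has_vector_derivative_mult[OF u has_vector_derivative_of_real[OF d\<phi>], of x]
        by (rule has_vector_derivative_at_within)
    qed (use ab in auto)
    moreover have "\<phi> l = 0" "\<phi> 0 = 0" using ab by auto
    ultimately have "integral {0..l} (\<lambda>x. u x * of_real (deriv \<phi> x) + u' x * of_real (\<phi> x)) = 0"
      by (simp add: integral_unique)
    moreover have i1: "integrable (lebesgue_on {0..l}) (\<lambda>x. u x * of_real (deriv \<phi> x))"
      by (intro continuous_imp_integrable_real continuous_intros cu c)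
    moreover have i2: "integrable (lebesgue_on {0..l}) (\<lambda>x. u' x * of_real (\<phi> x))"
      by (intro continuous_imp_integrable_real continuous_intros cu' c)
    ultimately show "(LINT x|lebesgue_on {0..l}. u x * of_real (deriv \<phi> x)) = - (LINT x|lebesgue_on {0..l}. u' x * of_real (\<phi> x))"
      using lebesgue_integral_eq_integral[OF Bochner_Integration.integrable_add[OF i1 i2]]
      by (simp add: Bochner_Integration.integral_add[OF i1 i2] eq_neg_iff_add_eq_0)
  qed
  then show ?thesis unfolding H1_interval_def using L2 cu cu' by blast
qed

context compact_metric_graph
begin

text \<open>
  The infimum that defines \<open>lambda2\<close> is taken over a nonempty set: one period of the sine on a single
  edge, extended by 0 to the other edges, is admissible.
\<close>

lemma mean_zero_function_exists:
  "\<exists>\<phi>. \<phi> \<in> graph_H1 G len \<and> (\<exists>e\<in>arcs G. \<exists>x\<in>{0..len e}. \<phi> e x \<noteq> 0) \<and> graph_integral G len \<phi> = 0"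
proof -
  obtain e0 where e0: "e0 \<in> arcs G" using arcs_nonempty by blast
  define l where "l = len e0"
  have l: "0 < l" using e0 len_pos by (simp add: l_def)
  define c where "c = 2 * pi / l"
  have c: "c \<noteq> 0" using l by (simp add: c_def)
  define s where "s x = complex_of_real (sin (c * x))" for x
  define \<phi> where "\<phi> e = (if e = e0 then s else (\<lambda>x. 0))" for e
  have ds: "(s has_vector_derivative of_real (c * cos (c * x))) (at x)" for x
    unfolding s_def by (rule has_vector_derivative_of_real)
      (auto intro!: derivative_eq_intros)
  have H1: "\<phi> e \<in> H1_interval (len e)" for e
  proof (cases "e = e0")
    case True
    have "continuous_on UNIV (\<lambda>x. complex_of_real (c * cos (c * x)))" by (intro continuous_intros)
    from smooth_in_H1_interval[OF ds this] show ?thesis by (simp add: True \<phi>_def)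
  next
    case False
    have "(\<lambda>x. 0) \<in> H1_interval (len e)" by (rule smooth_in_H1_interval[where u' = "\<lambda>x. 0"]) auto
    with False show ?thesis by (simp add: \<phi>_def)
  qed
  have ends: "s 0 = 0" "s l = 0" using l by (auto simp: s_def c_def)
  have cont: "continuous_on S (\<phi> e)" for S e by (auto simp: \<phi>_def s_def intro!: continuous_intros)
  have "\<phi> \<in> graph_H1 G len"
    unfolding graph_H1_def graph_continuous_def using H1 cont ends
    by (auto intro!: exI[of _ "\<lambda>v. 0"] simp: \<phi>_def l_def)
  moreover have "s (l / 4) \<noteq> 0" using l by (simp add: s_def c_def)
  then have "\<exists>e\<in>arcs G. \<exists>x\<in>{0..len e}. \<phi> e x \<noteq> 0"
    using e0 l by (intro bexI[of _ e0] bexI[of _ "l / 4"]) (auto simp: \<phi>_def l_def)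
  moreover have "graph_integral G len \<phi> = 0"
  proof -
    have "(s has_integral of_real (- cos (c * l) / c) - of_real (- cos (c * 0) / c)) {0..l}"
    proof (rule fundamental_theorem_of_calculus)
      fix x
      have "((\<lambda>x. - cos (c * x) / c) has_real_derivative sin (c * x)) (at x)"
        using c by (auto intro!: derivative_eq_intros)
      then show "((\<lambda>x. complex_of_real (- cos (c * x) / c)) has_vector_derivative s x) (at x within {0..l})"
        unfolding s_def by (rule has_vector_derivative_at_within[OF has_vector_derivative_of_real])
    qed (use l in simp)
    moreover have "c * l = 2 * pi" using l by (simp add: c_def)
    ultimately have "integral {0..l} s = 0" by (simp add: integral_unique)
    moreover have "integrable (lebesgue_on {0..l}) s"
      using cont[of "{0..l}" e0] by (intro continuous_imp_integrable_real) (simp add: \<phi>_def)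
    ultimately have "(LINT x|lebesgue_on {0..l}. s x) = 0" by (simp add: lebesgue_integral_eq_integral)
    then have "(LINT x|lebesgue_on {0..len e}. \<phi> e x) = 0" for e by (auto simp: \<phi>_def l_def)
    then show ?thesis by (simp add: graph_integral_def)
  qed
  ultimately show ?thesis by blast
qed

lemma graph_poincare:
  assumes conn: "edge_connectivity_ge G k" and k: "1 \<le> k" "k \<le> 2"
    and u: "u \<in> graph_H1 G len" and mean: "graph_integral G len u = 0"
  shows "(real k * pi / total_length G len)\<^sup>2 * graph_integral G len (\<lambda>e x. (cmod (u e x))\<^sup>2)
    \<le> graph_integral G len (\<lambda>e x. (cmod (H1_deriv (len e) (u e) x))\<^sup>2)"
proof -
  define g where "g e = H1_deriv (len e) (u e)" for e
  obtain U where cont: "\<And>e. e \<in> arcs G \<Longrightarrow> continuous_on {0..len e} (u e)"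
    and U: "\<And>e. e \<in> arcs G \<Longrightarrow> u e 0 = U (tail G e)" "\<And>e. e \<in> arcs G \<Longrightarrow> u e (len e) = U (head G e)"
    using u by (auto simp: graph_H1_def graph_continuous_def)
  have g: "L2_interval (len e) (g e)" "weak_deriv (len e) (u e) (g e)" if "e \<in> arcs G" for e
    using H1_deriv_weak_deriv[of "u e" "len e"] u that by (auto simp: graph_H1_def g_def)
  have iu: "integrable (lebesgue_on {0..len e}) (u e)" if "e \<in> arcs G" for e
    using cont[OF that] by (rule continuous_imp_integrable_real)
  have ig: "integrable (lebesgue_on {0..len e}) (g e)" if "e \<in> arcs G" for e
    using g(1)[OF that] by (rule L2_interval_integrable)
  have sum0: "(\<Sum>e\<in>arcs G. LINT x|lebesgue_on {0..len e}. u e x) = 0" using mean by (simp add: graph_integral_def)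
  have re: "(real k * pi / total_length G len)\<^sup>2 * (\<Sum>e\<in>arcs G. LINT x|lebesgue_on {0..len e}. (Re (u e x))\<^sup>2)
    \<le> (\<Sum>e\<in>arcs G. LINT x|lebesgue_on {0..len e}. \<bar>Re (g e x)\<bar>\<^sup>2)"
  proof (rule graph_poincare_real[OF conn k, where U = "\<lambda>v. Re (U v)"])
    fix e assume e: "e \<in> arcs G"
    show c: "continuous_on {0..len e} (\<lambda>x. Re (u e x))" using cont[OF e] by (intro continuous_intros)
    show "integrable (lebesgue_on {0..len e}) (\<lambda>x. \<bar>Re (g e x)\<bar>)" using ig[OF e] by auto
    show "integrable (lebesgue_on {0..len e}) (\<lambda>x. \<bar>Re (g e x)\<bar>\<^sup>2)"
      using L2_interval_component[OF g(1)[OF e]] by simp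
    show "\<bar>Re (u e x) - Re (u e y)\<bar> \<le> (LINT z:{y<..<x}|lebesgue_on {0..len e}. \<bar>Re (g e z)\<bar>)"
      if "0 \<le> y" "y \<le> x" "x \<le> len e" for x y
      using that ig[OF e] weak_deriv_component(1)[OF cont[OF e] g[OF e]]
      by (intro weak_derivative_increment[OF c]) auto
  next
    have "(\<Sum>e\<in>arcs G. LINT x|lebesgue_on {0..len e}. Re (u e x))
        = Re (\<Sum>e\<in>arcs G. LINT x|lebesgue_on {0..len e}. u e x)"
      using iu by (simp add: Re_sum)
    then show "(\<Sum>e\<in>arcs G. LINT x|lebesgue_on {0..len e}. Re (u e x)) = 0" by (simp add: sum0)
  qed (use U in auto)
  have im: "(real k * pi / total_length G len)\<^sup>2 * (\<Sum>e\<in>arcs G. LINT x|lebesgue_on {0..len e}. (Im (u e x))\<^sup>2)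
    \<le> (\<Sum>e\<in>arcs G. LINT x|lebesgue_on {0..len e}. \<bar>Im (g e x)\<bar>\<^sup>2)"
  proof (rule graph_poincare_real[OF conn k, where U = "\<lambda>v. Im (U v)"])
    fix e assume e: "e \<in> arcs G"
    show c: "continuous_on {0..len e} (\<lambda>x. Im (u e x))" using cont[OF e] by (intro continuous_intros)
    show "integrable (lebesgue_on {0..len e}) (\<lambda>x. \<bar>Im (g e x)\<bar>)" using ig[OF e] by auto
    show "integrable (lebesgue_on {0..len e}) (\<lambda>x. \<bar>Im (g e x)\<bar>\<^sup>2)"
      using L2_interval_component[OF g(1)[OF e]] by simp
    show "\<bar>Im (u e x) - Im (u e y)\<bar> \<le> (LINT z:{y<..<x}|lebesgue_on {0..len e}. \<bar>Im (g e z)\<bar>)"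
      if "0 \<le> y" "y \<le> x" "x \<le> len e" for x y
      using that ig[OF e] weak_deriv_component(2)[OF cont[OF e] g[OF e]]
      by (intro weak_derivative_increment[OF c]) auto
  next
    have "(\<Sum>e\<in>arcs G. LINT x|lebesgue_on {0..len e}. Im (u e x))
        = Im (\<Sum>e\<in>arcs G. LINT x|lebesgue_on {0..len e}. u e x)"
      using iu by (simp add: Im_sum)
    then show "(\<Sum>e\<in>arcs G. LINT x|lebesgue_on {0..len e}. Im (u e x)) = 0" by (simp add: sum0)
  qed (use U in auto)
  have split: "graph_integral G len (\<lambda>e x. (cmod (h e x))\<^sup>2)
      = (\<Sum>e\<in>arcs G. LINT x|lebesgue_on {0..len e}. (Re (h e x))\<^sup>2) + (\<Sum>e\<in>arcs G. LINT x|lebesgue_on {0..len e}. (Im (h e x))\<^sup>2)"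
    if "\<And>e. e \<in> arcs G \<Longrightarrow> L2_interval (len e) (h e)" for h :: "'e \<Rightarrow> real \<Rightarrow> complex"
    unfolding graph_integral_def cmod_power2 sum.distrib[symmetric]
    using L2_interval_component[OF that] by (intro sum.cong Bochner_Integration.integral_add) auto
  have "L2_interval (len e) (u e)" if "e \<in> arcs G" for e
    using u that by (auto simp: graph_H1_def H1_interval_def)
  from split[OF this] split[OF g(1)] re im show ?thesis
    by (simp add: distrib_left g_def)
qed

lemma graph_norm_pos:
  assumes u: "u \<in> graph_H1 G len" and nz: "e0 \<in> arcs G" "x0 \<in> {0..len e0}" "u e0 x0 \<noteq> 0"
  shows "0 < graph_integral G len (\<lambda>e x. (cmod (u e x))\<^sup>2)"
  unfolding graph_integral_def
proof (rule sum_pos2[OF finite_arcs nz(1)])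
  have "continuous_on {0..len e0} (\<lambda>x. (cmod (u e0 x))\<^sup>2)"
    using u nz(1) by (auto simp: graph_H1_def graph_continuous_def intro!: continuous_intros)
  then have "(LINT x|lebesgue_on {0..len e0}. (cmod (u e0 x))\<^sup>2) \<noteq> 0"
    using nz len_pos[OF nz(1)] by (subst integralL_eq_0_iff) auto
  moreover have nn: "0 \<le> (LINT x|lebesgue_on {0..len e}. (cmod (u e x))\<^sup>2)" for e by simp
  ultimately show "0 < (LINT x|lebesgue_on {0..len e0}. (cmod (u e0 x))\<^sup>2)"
    by (metis less_eq_real_def)
  show "0 \<le> (LINT x|lebesgue_on {0..len e}. (cmod (u e x))\<^sup>2)" for e by simp
qed

lemma lambda2_lower_bound:
  assumes conn: "edge_connectivity_ge G k" and k: "1 \<le> k" "k \<le> 2"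
  shows "(real k * pi / total_length G len)\<^sup>2 \<le> lambda2 G len"
  unfolding lambda2_def
proof (rule cInf_greatest)
  fix r assume "r \<in> {rayleigh_quotient G len \<phi> | \<phi>. \<phi> \<in> graph_H1 G len \<and>
      (\<exists>e\<in>arcs G. \<exists>x\<in>{0..len e}. \<phi> e x \<noteq> 0) \<and> graph_integral G len \<phi> = 0}"
  then obtain \<phi> e x where r: "r = rayleigh_quotient G len \<phi>" and \<phi>: "\<phi> \<in> graph_H1 G len" "graph_integral G len \<phi> = 0"
    and nz: "e \<in> arcs G" "x \<in> {0..len e}" "\<phi> e x \<noteq> 0" by blast
  show "(real k * pi / total_length G len)\<^sup>2 \<le> r"
    unfolding r rayleigh_quotient_def
    using graph_poincare[OF conn k \<phi>] graph_norm_pos[OF \<phi>(1) nz] by (simp add: pos_le_divide_eq)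
next
  obtain \<phi> where "\<phi> \<in> graph_H1 G len \<and> (\<exists>e\<in>arcs G. \<exists>x\<in>{0..len e}. \<phi> e x \<noteq> 0) \<and> graph_integral G len \<phi> = 0"
    using mean_zero_function_exists ..
  then have "rayleigh_quotient G len \<phi> \<in> {rayleigh_quotient G len \<phi> | \<phi>. \<phi> \<in> graph_H1 G len \<and>
      (\<exists>e\<in>arcs G. \<exists>x\<in>{0..len e}. \<phi> e x \<noteq> 0) \<and> graph_integral G len \<phi> = 0}"
    by (intro CollectI exI[of _ \<phi>] conjI[OF refl])
  then show "{rayleigh_quotient G len \<phi> | \<phi>. \<phi> \<in> graph_H1 G len \<and>
      (\<exists>e\<in>arcs G. \<exists>x\<in>{0..len e}. \<phi> e x \<noteq> 0) \<and> graph_integral G len \<phi> = 0} \<noteq> {}"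
    by (rule ex_in_conv[THEN iffD1, OF exI])
qed

lemma mu1_p6_lower_bound:
  assumes "edge_connectivity_ge G k" and "1 \<le> k" "k \<le> 2"
  shows "real k * pi / 2 \<le> mu1_p6 G len"
proof -
  define L where "L = total_length G len"
  have L: "0 < L" unfolding L_def by (rule total_length_pos)
  have "real k * pi / (2 * L) = sqrt ((real k * pi / (2 * L))\<^sup>2)" using L by simp
  also have "(real k * pi / (2 * L))\<^sup>2 = (real k * pi / L)\<^sup>2 / 4" by (simp add: power_divide power_mult_distrib)
  also have "sqrt \<dots> \<le> sqrt (lambda2 G len / 4)"
    using lambda2_lower_bound[OF assms] by (intro real_sqrt_le_mono divide_right_mono) (auto simp: L_def)
  finally have "L * (real k * pi / (2 * L)) \<le> L * sqrt (lambda2 G len / 4)" using L by (intro mult_left_mono) auto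
  then show ?thesis using L by (simp add: mu1_p6_def L_def)
qed

end

theorem theorem2p3:
  fixes G :: "('v, 'e) pre_digraph" and len :: "'e \<Rightarrow> real"
  assumes "compact_metric_graph G len"
  shows "mu1_p6 G len \<ge> pi / 2 \<and> (admits_cycle_covering G \<longrightarrow> mu1_p6 G len \<ge> pi)"
proof (intro conjI impI)
  interpret compact_metric_graph G len by fact
  show "mu1_p6 G len \<ge> pi / 2"
    using mu1_p6_lower_bound[OF connected_edge_connectivity[OF fin_digraph_axioms graph_connected]] by simp
  assume "admits_cycle_covering G"
  from cycle_covering_edge_connectivity[OF fin_digraph_axioms graph_connected this]
  show "mu1_p6 G len \<ge> pi" using mu1_p6_lower_bound by fastforce
qed

end
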